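(* Let $\rho$ and $\sigma$ be two faithful states (invertible density matrices) on $\mathcal{M}$. Let $\mathcal{E}_\tau$ be the tracial conditional expectation onto a von Neumann subalgebra $\mathcal{N}$ of $\mathcal{M}$, and let $\rho_{\mathcal{N}} = \mathcal{E}_\tau(\rho)$ and $\sigma_{\mathcal{N}} = \mathcal{E}_\tau(\sigma)$. Then, with $\|\cdot\|_2$ denoting the Hilbert-Schmidt norm, $$S(\rho||\sigma) - S(\rho_{\mathcal{N}}||\sigma_{\mathcal{N}}) \ \geq\ \left(\frac{\pi}{4}\right)^{4} \|\Delta_{\sigma,\rho}\|^{-2}\, \big\|\sigma_{\mathcal{N}}^{1/2}\rho_{\mathcal{N}}^{-1/2} \rho^{1/2} - \sigma^{1/2}\big\|_2^4 .$$
   Context: $\mathcal{M}$ is a finite dimensional von Neumann algebra, regarded as a unital $*$-subalgebra of $M_n(\mathbb{C})$; $\mathrm{Tr}$ is the trace on $M_n(\mathbb{C})$, $\mathbf{1}$ is the identity, and $\langle X,Y\rangle_{HS}=\mathrm{Tr}[X^*Y]$ with $\|X\|_2=\mathrm{Tr}[X^*X]^{1/2}$. A von Neumann subalgebra $\mathcal{N}\subset\mathcal{M}$ is a $*$-subalgebra containing $\mathbf{1}$. States on $\mathcal{M}$ are identified with density matrices $\rho\in\mathcal{M}$ ($\rho\ge 0$, $\mathrm{Tr}[\rho]=1$) through $\rho(X)=\mathrm{Tr}[\rho X]$; the state is faithful iff $\rho$ is invertible. The tracial conditional expectation $\mathcal{E}_\tau:\mathcal{M}\to\mathcal{N}$ is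 the orthogonal projection of $\mathcal{M}$ onto $\mathcal{N}$ with respect to $\langle X,Y\rangle_\tau = n^{-1}\mathrm{Tr}[X^*Y]$ (equivalently, with respect to $\langle\cdot,\cdot\rangle_{HS}$). The Umegaki relative entropy is $S(\rho||\sigma)=\mathrm{Tr}[\rho(\log\rho-\log\sigma)]$. The relative modular operator $\Delta_{\sigma,\rho}$ is the linear operator on $\mathcal{M}$ given by $\Delta_{\sigma,\rho}(X)=\sigma X\rho^{-1}$, and $\|\Delta_{\sigma,\rho}\|$ is its operator norm on $(\mathcal{M},\langle\cdot,\cdot\rangle_{HS})$. *)

theory Defs
  imports "HOL-Analysis.Analysis"
begin

text \<open>
  Type \<open>complex^'n^'n\<close> plays the role of $M_n(\mathbf{C})$ with $n$ = \<open>CARD('n)\<close>.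
\<close>

definition adj :: "complex^'n^'m \<Rightarrow> complex^'m^'n" where
  "adj A = map_matrix cnj (transpose A)"

definition vn_algebra :: "(complex^'n^'n) set \<Rightarrow> bool" where
  "vn_algebra M \<longleftrightarrow>
     mat 1 \<in> M \<and>
     (\<forall>X\<in>M. \<forall>Y\<in>M. X + Y \<in> M) \<and>
     (\<forall>c. \<forall>X\<in>M. map_matrix ((*) c) X \<in> M) \<and>
     (\<forall>X\<in>M. \<forall>Y\<in>M. X ** Y \<in> M) \<and>
     (\<forall>X\<in>M. adj X \<in> M)"

definition hs_inner :: "complex^'n^'n \<Rightarrow> complex^'n^'n \<Rightarrow> complex" where
  "hs_inner X Y = trace (adj X ** Y)"

definition hs_norm :: "complex^'n^'n \<Rightarrow> real" where
  "hs_norm X = sqrt (Re (hs_inner X X))"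

definition tau_inner :: "complex^'n^'n \<Rightarrow> complex^'n^'n \<Rightarrow> complex" where
  "tau_inner X Y = trace (adj X ** Y) / of_nat CARD('n)"

definition pos_semidef :: "complex^'n^'n \<Rightarrow> bool" where
  "pos_semidef A \<longleftrightarrow>
     adj A = A \<and> (\<forall>x. 0 \<le> Re (\<Sum>i\<in>UNIV. cnj (x $ i) * (A *v x) $ i))"

definition density_matrix :: "(complex^'n^'n) set \<Rightarrow> complex^'n^'n \<Rightarrow> bool" where
  "density_matrix M \<rho> \<longleftrightarrow> \<rho> \<in> M \<and> pos_semidef \<rho> \<and> trace \<rho> = 1"

definition faithful_state :: "(complex^'n^'n) set \<Rightarrow> complex^'n^'n \<Rightarrow> bool" where
  "faithful_state M \<rho> \<longleftrightarrow> density_matrix M \<rho> \<and> invertible \<rho>"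

definition unitary_mat :: "complex^'n^'n \<Rightarrow> bool" where
  "unitary_mat U \<longleftrightarrow> adj U ** U = mat 1 \<and> U ** adj U = mat 1"

definition real_diag :: "('n \<Rightarrow> real) \<Rightarrow> complex^'n^'n" where
  "real_diag d = (\<chi> i j. if i = j then complex_of_real (d i) else 0)"

text \<open>
  Functional calculus: $f(U \mathrm{diag}(d) U^*) = U \mathrm{diag}(f \circ d) U^*$.
  The result does not depend on the chosen diagonalisation; the value is meaningful only for
  self-adjoint \<open>A\<close>, where a diagonalisation exists by the spectral theorem.
\<close>

definition mat_fun :: "(real \<Rightarrow> real) \<Rightarrow> complex^'n^'n \<Rightarrow> complex^'n^'n" where
  "mat_fun f A = (THE B. \<exists>U d. unitary_mat U \<and>
     A = U ** real_diag d ** adj U \<and> B = U ** real_diag (\<lambda>i. f (d i)) ** adj U)"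

definition mat_log :: "complex^'n^'n \<Rightarrow> complex^'n^'n" where
  "mat_log = mat_fun ln"

definition mat_powr :: "complex^'n^'n \<Rightarrow> real \<Rightarrow> complex^'n^'n" where
  "mat_powr A s = mat_fun (\<lambda>x. x powr s) A"

text \<open>The trace below is real for self-adjoint arguments, so \<open>Re\<close> only changes the type.\<close>

definition rel_entropy :: "complex^'n^'n \<Rightarrow> complex^'n^'n \<Rightarrow> real" where
  "rel_entropy \<rho> \<sigma> = Re (trace (\<rho> ** (mat_log \<rho> - mat_log \<sigma>)))"

text \<open>
  The orthogonal projection onto \<open>N\<close>. The ambient algebra does not enter: for \<open>N \<subseteq> M\<close>,
  the projection of \<open>M\<close> onto \<open>N\<close> is the restriction to \<open>M\<close> of this map.
\<close>

definition tracial_cond_exp :: "(complex^'n^'n) set \<Rightarrow> complex^'n^'n \<Rightarrow> complex^'n^'n" where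
  "tracial_cond_exp N X = (THE Y. Y \<in> N \<and> (\<forall>Z\<in>N. tau_inner Z (X - Y) = 0))"

definition rel_modular :: "complex^'n^'n \<Rightarrow> complex^'n^'n \<Rightarrow> complex^'n^'n \<Rightarrow> complex^'n^'n" where
  "rel_modular \<sigma> \<rho> X = \<sigma> ** X ** matrix_inv \<rho>"

text \<open>
  Operator norm of \<open>T\<close> on $(M, \langle\cdot,\cdot\rangle_{HS})$; the library's \<open>onorm\<close>
  would take the supremum over the whole type rather than over \<open>M\<close>.
\<close>

definition op_norm_on ::
  "(complex^'n^'n) set \<Rightarrow> (complex^'n^'n \<Rightarrow> complex^'n^'n) \<Rightarrow> real" where
  "op_norm_on M T = (SUP X\<in>{X\<in>M. hs_norm X \<le> 1}. hs_norm (T X))"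

end

theory Submission
  imports Defs
begin

text \<open>
  Write $\Delta(X) = \sigma X \rho^{-1}$ and $\Delta_N(X) = \sigma_N X \rho_N^{-1}$. The map
  $J X = X \rho_N^{-1/2} \rho^{1/2}$ is isometric on \<open>N\<close>, satisfies $J^* \Delta J = \Delta_N$ there,
  and sends $v = \rho_N^{1/2}$ to $\rho^{1/2}$. With
  $w_t = J (t + \Delta_N)^{-1} v - (t + \Delta)^{-1} J v$ the integral representation of the logarithm
  bounds the entropy difference below by $\int_0^\infty t \|w_t\|^2 dt$, whereas the one of the square root
  gives $\pi (\Delta^{1/2} J v - J \Delta_N^{1/2} v) = \int_0^\infty t^{1/2} w_t dt$. One splits the
  latter at \<open>T\<close>: up to \<open>T\<close> the Cauchy--Schwarz inequality applies, the tail is at most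
  $4 \|\Delta\| T^{-1/2}$, and \<open>T\<close> is then optimised. Everything reduces to finite sums over spectra,
  so explicit antiderivatives and monotonicity replace the operator integrals.
\<close>

section \<open>Finite spectral calculus and compressions\<close>

text \<open>Both properties of \<open>J\<close> rest on one fact: the trace of \<rho> or \<sigma>
  against an element of \<open>N\<close> is unchanged when the state is replaced by its conditional
  expectation. Cyclicity of the trace leaves \<rho> or \<sigma> facing a product of elements of
  \<open>N\<close>. This ties isometry and compression to \<open>N\<close>, so functions of the
  modular operator of \<open>N\<close> must be shown to keep \<open>v\<close> inside
  \<open>N\<close>. The norm of the modular operator enters only through its value at the unit
  vector \<rho>^(1/2), which lies in \<open>M\<close>. Write g for the entropy difference, K for the
  norm and d for the vector in the claim. The part up to \<open>T\<close> contributes at most sqrt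
  (T g). Adding the tail 4 K / sqrt T and taking sqrt T = 2 K^(1/2) / g^(1/4) gives pi |d| \<le> 4
  K^(1/2) g^(1/4). Its fourth power explains the factor (pi/4)^4, the exponent 4 and the factor
  K^(-2).\<close>

locale spectral_operator =
  fixes P :: "'k::finite \<Rightarrow> 'a::real_inner \<Rightarrow> 'a" and a :: "'k \<Rightarrow> real"
  assumes linear_P: "linear (P k)"
    and P_sym: "P k x \<bullet> y = x \<bullet> P k y"
    and P_P: "P k (P l x) = (if k = l then P k x else 0)"
    and sum_P: "(\<Sum>k\<in>UNIV. P k x) = x"
begin

text \<open>Projections are labelled by indices rather than by eigenvalues, so values of
  \<open>a\<close> may repeat. Pairs of eigenvector indices can then label the spectrum of a modular
  operator, whose eigenvalues are quotients that may coincide.\<close>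

definition fcalc :: "(real \<Rightarrow> real) \<Rightarrow> 'a \<Rightarrow> 'a" where
  "fcalc f x = (\<Sum>k\<in>UNIV. f (a k) *\<^sub>R P k x)"

lemma linear_fcalc: "linear (fcalc f)"
  unfolding fcalc_def
  by (rule linear_compose_sum) (auto intro!: linear_compose_scale_right linear_P)

lemma inner_fcalc: "fcalc f x \<bullet> y = (\<Sum>k\<in>UNIV. f (a k) * (P k x \<bullet> y))"
  by (simp add: fcalc_def inner_sum_left)

lemma fcalc_sym: "fcalc f x \<bullet> y = x \<bullet> fcalc f y"
  by (simp add: fcalc_def inner_sum_left inner_sum_right P_sym)

lemma P_fcalc: "P k (fcalc f x) = f (a k) *\<^sub>R P k x"
proof -
  have "P k (fcalc f x) = (\<Sum>l\<in>UNIV. f (a l) *\<^sub>R P k (P l x))"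
    by (simp add: fcalc_def linear_sum[OF linear_P] linear_cmul[OF linear_P])
  also have "\<dots> = (\<Sum>l\<in>UNIV. if k = l then f (a l) *\<^sub>R P k x else 0)"
    by (intro sum.cong) (auto simp: P_P)
  finally show ?thesis by simp
qed

lemma fcalc_fcalc: "fcalc f (fcalc g x) = fcalc (\<lambda>t. f t * g t) x"
  by (simp add: fcalc_def[of f] P_fcalc) (simp add: fcalc_def)

lemma fcalc_add: "fcalc (\<lambda>t. f t + g t) x = fcalc f x + fcalc g x"
  by (simp add: fcalc_def scaleR_left_distrib sum.distrib)

lemma fcalc_diff: "fcalc (\<lambda>t. f t - g t) x = fcalc f x - fcalc g x"
  by (simp add: fcalc_def scaleR_left_diff_distrib sum_subtractf)

lemma fcalc_cmul: "fcalc (\<lambda>t. c * f t) x = c *\<^sub>R fcalc f x"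
  by (simp add: fcalc_def scaleR_right.sum)

lemma fcalc_const: "fcalc (\<lambda>t. c) x = c *\<^sub>R x"
  by (simp add: fcalc_def scaleR_right.sum [symmetric] sum_P)

lemma fcalc_cong: "(\<And>k. f (a k) = g (a k)) \<Longrightarrow> fcalc f x = fcalc g x"
  by (simp add: fcalc_def)

lemma inner_P_nonneg: "0 \<le> P k x \<bullet> x"
proof -
  have "P k x \<bullet> x = P k (P k x) \<bullet> x" by (simp add: P_P)
  also have "\<dots> = P k x \<bullet> P k x" by (rule P_sym)
  finally show ?thesis by simp
qed

lemma sum_inner_P: "(\<Sum>k\<in>UNIV. P k x \<bullet> y) = x \<bullet> y"
  by (simp add: inner_sum_left [symmetric] sum_P)

lemma fcalc_nonneg: "(\<And>k. 0 \<le> f (a k)) \<Longrightarrow> 0 \<le> fcalc f x \<bullet> x"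
  unfolding inner_fcalc by (intro sum_nonneg mult_nonneg_nonneg inner_P_nonneg) auto

text \<open>The squared norm sums the squared function values against the nonnegative weights
  \<open>P k x \<bullet> x\<close>, so it sees only absolute values on the spectrum.\<close>

lemma norm_fcalc_mono:
  assumes "\<And>k. \<bar>f (a k)\<bar> \<le> \<bar>g (a k)\<bar>"
  shows "norm (fcalc f x) \<le> norm (fcalc g x)"
proof -
  have *: "(norm (fcalc h x))\<^sup>2 = (\<Sum>k\<in>UNIV. (h (a k))\<^sup>2 * (P k x \<bullet> x))" for h
  proof -
    have "(norm (fcalc h x))\<^sup>2 = fcalc h (fcalc h x) \<bullet> x"
      by (simp add: power2_norm_eq_inner fcalc_sym)
    then show ?thesis by (simp add: fcalc_fcalc inner_fcalc power2_eq_square)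
  qed
  have "(norm (fcalc f x))\<^sup>2 \<le> (norm (fcalc g x))\<^sup>2"
    unfolding * using assms
    by (intro sum_mono mult_right_mono inner_P_nonneg) (simp add: abs_le_square_iff)
  then show ?thesis by (rule power2_le_imp_le) simp
qed

text \<open>On the finite spectrum every function agrees with its Lagrange interpolation polynomial.\<close>

lemma fcalc_invariant:
  assumes S: "subspace S" and inv: "\<And>x. x \<in> S \<Longrightarrow> fcalc (\<lambda>t. t) x \<in> S" and x: "x \<in> S"
  shows "fcalc f x \<in> S"
proof -
  have shift: "fcalc (\<lambda>t. (t - e) / d) y \<in> S" if "y \<in> S" for e d y
  proof -
    have "fcalc (\<lambda>t. (t - e) / d) y = fcalc (\<lambda>t. inverse d * (t + - e)) y"
      by (simp add: divide_inverse mult.commute)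
    also have "\<dots> = inverse d *\<^sub>R (fcalc (\<lambda>t. t) y - e *\<^sub>R y)"
      by (simp only: fcalc_cmul fcalc_add fcalc_const) simp
    finally show ?thesis
      using S inv[OF that] that by (simp add: subspace_diff subspace_scale)
  qed
  have prod: "finite E \<Longrightarrow> fcalc (\<lambda>t. \<Prod>e\<in>E. (t - e) / (c - e)) y \<in> S" if "y \<in> S" for E c y
  proof (induction E rule: finite_induct)
    case empty
    then show ?case using that by (simp add: fcalc_const)
  next
    case (insert e E)
    have "(\<lambda>t. \<Prod>e\<in>insert e E. (t - e) / (c - e)) = (\<lambda>t. (t - e) / (c - e) * (\<Prod>e\<in>E. (t - e) / (c - e)))"
      using insert by simp
    then have "fcalc (\<lambda>t. \<Prod>e\<in>insert e E. (t - e) / (c - e)) y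
      = fcalc (\<lambda>t. (t - e) / (c - e)) (fcalc (\<lambda>t. \<Prod>e\<in>E. (t - e) / (c - e)) y)"
      by (simp only: fcalc_fcalc)
    then show ?case using shift insert by simp
  qed
  \<comment> \<open>The nodes are the distinct values in \<open>range a\<close>; indexing by
    \<open>k\<close> would produce zero denominators at repeated eigenvalues.\<close>
  define L where "L c t = (\<Prod>e\<in>range a - {c}. (t - e) / (c - e))" for c t
  have L: "L (a l) (a k) = (if a k = a l then 1 else 0)" for k l
    unfolding L_def by (auto intro!: prod.neutral)
  have "fcalc f x = fcalc (\<lambda>t. \<Sum>c\<in>range a. f c * L c t) x"
  proof (rule fcalc_cong)
    fix k
    have "(\<Sum>c\<in>range a. f c * L c (a k)) = (\<Sum>c\<in>range a. if c = a k then f c else 0)"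
      by (intro sum.cong) (auto simp: L)
    then show "f (a k) = (\<Sum>c\<in>range a. f c * L c (a k))" by simp
  qed
  also have "\<dots> = (\<Sum>c\<in>range a. f c *\<^sub>R fcalc (L c) x)"
    unfolding fcalc_def scaleR_sum_left scaleR_right.sum scaleR_scaleR by (rule sum.swap)
  also have "\<dots> \<in> S"
    using S prod[OF x] by (intro subspace_sum subspace_scale) (auto simp: L_def[abs_def])
  finally show ?thesis .
qed

end

section \<open>The square root as an integral of resolvents\<close>

lemma arctan_sqrt_reflect:
  assumes "0 < x" "0 < t"
  shows "arctan (sqrt t / sqrt x) + arctan (sqrt x / sqrt t) = pi / 2"
  using arctan_inverse[of "sqrt x / sqrt t"] assms by (simp add: divide_simps)

text \<open>The substitution t = u^2 turns the integrand into 2 x / (u^2 + x), with total integral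
  \<open>pi * sqrt x\<close>. The form \<open>1 / t - 1 / (t + x)\<close> isolates a term
  independent of \<open>x\<close>, which cancels when two operators are compared.\<close>

lemma DERIV_sqrt_arctan:
  assumes x: "0 < x" and t: "0 < t"
  shows "((\<lambda>t. 2 * sqrt x * arctan (sqrt t / sqrt x)) has_real_derivative
    sqrt t * (1 / t - 1 / (t + x))) (at t)"
proof -
  have "((\<lambda>t. 2 * sqrt x * arctan (sqrt t / sqrt x)) has_real_derivative
     2 * sqrt x * (inverse (1 + (sqrt t / sqrt x)\<^sup>2) * (inverse (sqrt t) / 2 / sqrt x))) (at t)"
    using x t by (auto intro!: derivative_eq_intros)
  also have "2 * sqrt x * (inverse (1 + (sqrt t / sqrt x)\<^sup>2) * (inverse (sqrt t) / 2 / sqrt x))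
     = inverse (1 + t / x) / sqrt t"
  proof -
    have gen: "2 * p * (inverse (1 + c) * (inverse q / 2 / p)) = inverse (1 + c) / q"
      if "p \<noteq> 0" for p q c :: real
      using that by (simp add: divide_simps)
    have "(sqrt t / sqrt x)\<^sup>2 = t / x" using x t by (simp add: power_divide)
    then show ?thesis using gen[of "sqrt x" "t / x" "sqrt t"] x by simp
  qed
  also have "\<dots> = sqrt t * (1 / t - 1 / (t + x))"
  proof -
    obtain q where q: "0 < q" "t = q * q" "sqrt t = q"
      using t that[of "sqrt t"] by simp
    have "x + q * q \<noteq> 0" using x q(1) by (smt (verit) mult_pos_pos)
    then show ?thesis using x q(1) unfolding q(3) q(2)
      by (simp add: divide_simps)
  qed
  finally show ?thesis .
qed

text \<open>Compression is stated weakly, as equality of bilinear forms on \<open>S\<close>, which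
  avoids an adjoint of \<open>J\<close>. Invariance of \<open>S\<close> keeps functions of the
  compressed operator, applied to \<open>v\<close>, in the domain where \<open>J\<close> is
  isometric.\<close>

locale spectral_compression =
  D: spectral_operator P a + E: spectral_operator Q b
  for P :: "'k::finite \<Rightarrow> 'a::real_inner \<Rightarrow> 'a" and a
    and Q :: "'l::finite \<Rightarrow> 'b::real_inner \<Rightarrow> 'b" and b +
  fixes J :: "'b \<Rightarrow> 'a" and S :: "'b set" and v :: 'b
  assumes a_pos: "0 < a k" and b_pos: "0 < b l"
    and linear_J: "linear J" and subspace_S: "subspace S" and v_in_S: "v \<in> S"
    and E_inv: "x \<in> S \<Longrightarrow> E.fcalc (\<lambda>t. t) x \<in> S"
    and isometric: "x \<in> S \<Longrightarrow> y \<in> S \<Longrightarrow> J x \<bullet> J y = x \<bullet> y"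
    and compression: "x \<in> S \<Longrightarrow> y \<in> S \<Longrightarrow> J x \<bullet> D.fcalc (\<lambda>t. t) (J y) = x \<bullet> E.fcalc (\<lambda>t. t) y"
    and norm_v: "norm v = 1"
begin

lemma norm_Jv: "norm (J v) = 1"
  using isometric[OF v_in_S v_in_S] norm_v by (simp add: norm_eq_sqrt_inner)

lemma E_fcalc_in_S: "E.fcalc f v \<in> S"
  using subspace_S E_inv v_in_S by (rule E.fcalc_invariant)

lemma norm_J: "x \<in> S \<Longrightarrow> norm (J x) = norm x"
  using isometric[of x x] by (simp add: norm_eq_sqrt_inner)

text \<open>A compression cannot lengthen the image of \<open>v\<close>: test that image against
  itself and move to the large space. One constant can then control the tails of both
  operators.\<close>

lemma norm_E_v_le: "norm (E.fcalc (\<lambda>t. t) v) \<le> norm (D.fcalc (\<lambda>t. t) (J v))"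
proof -
  let ?x = "E.fcalc (\<lambda>t. t) v"
  have "norm ?x * norm ?x = J ?x \<bullet> D.fcalc (\<lambda>t. t) (J v)"
    by (simp add: compression[OF E_fcalc_in_S v_in_S] norm_eq_sqrt_inner)
  also have "\<dots> \<le> norm ?x * norm (D.fcalc (\<lambda>t. t) (J v))"
    using norm_cauchy_schwarz[of "J ?x"] by (simp add: norm_J[OF E_fcalc_in_S])
  finally show ?thesis
    by (cases "norm ?x = 0") auto
qed

text \<open>In the application \<open>v\<close> and \<open>J v\<close> are the square roots of the
  reduced and the full density matrix. Each quadratic form of the logarithm is then minus a relative
  entropy, and \<open>gap\<close> is the loss of relative entropy.\<close>

definition gap :: real where
  "gap = v \<bullet> E.fcalc ln v - J v \<bullet> D.fcalc ln (J v)"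

definition resolvent_defect :: "real \<Rightarrow> 'a" where
  "resolvent_defect t = J (E.fcalc (\<lambda>x. 1 / (t + x)) v) - D.fcalc (\<lambda>x. 1 / (t + x)) (J v)"

lemma norm_resolvent_defect_le:
  assumes t: "0 < t"
  shows "t * (norm (resolvent_defect t))\<^sup>2 \<le>
    J v \<bullet> D.fcalc (\<lambda>x. 1 / (t + x)) (J v) - v \<bullet> E.fcalc (\<lambda>x. 1 / (t + x)) v"
proof -
  define \<alpha> where "\<alpha> = E.fcalc (\<lambda>x. 1 / (t + x)) v"
  define \<beta> where "\<beta> = D.fcalc (\<lambda>x. 1 / (t + x)) (J v)"
  define w where "w = resolvent_defect t"
  let ?D = "D.fcalc (\<lambda>t. t)" let ?E = "E.fcalc (\<lambda>t. t)"
  have w: "w = J \<alpha> - \<beta>" by (simp add: w_def \<alpha>_def \<beta>_def resolvent_defect_def)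
  have \<alpha>S: "\<alpha> \<in> S" unfolding \<alpha>_def by (rule E_fcalc_in_S)
  have a0: "t + a k \<noteq> 0" and b0: "t + b l \<noteq> 0" for k l
    using t a_pos[of k] b_pos[of l] by auto
  have \<beta>: "t *\<^sub>R \<beta> + ?D \<beta> = J v"
  proof -
    have "t *\<^sub>R \<beta> + ?D \<beta> = D.fcalc (\<lambda>x. t + x) \<beta>"
      by (simp add: D.fcalc_add D.fcalc_const)
    also have "\<dots> = D.fcalc (\<lambda>x. 1) (J v)"
      unfolding \<beta>_def D.fcalc_fcalc by (rule D.fcalc_cong) (simp add: a0)
    finally show ?thesis by (simp add: D.fcalc_const)
  qed
  have \<alpha>: "t *\<^sub>R \<alpha> + ?E \<alpha> = v"
  proof -
    have "t *\<^sub>R \<alpha> + ?E \<alpha> = E.fcalc (\<lambda>x. t + x) \<alpha>"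
      by (simp add: E.fcalc_add E.fcalc_const)
    also have "\<dots> = E.fcalc (\<lambda>x. 1) v"
      unfolding \<alpha>_def E.fcalc_fcalc by (rule E.fcalc_cong) (simp add: b0)
    finally show ?thesis by (simp add: E.fcalc_const)
  qed
  have Jv: "J \<alpha> \<bullet> J v = \<alpha> \<bullet> v" by (rule isometric[OF \<alpha>S v_in_S])
  have "J \<alpha> \<bullet> (t *\<^sub>R J \<alpha> + ?D (J \<alpha>)) = \<alpha> \<bullet> (t *\<^sub>R \<alpha> + ?E \<alpha>)"
    by (simp add: inner_add_right isometric[OF \<alpha>S \<alpha>S] compression[OF \<alpha>S \<alpha>S])
  then have 1: "J \<alpha> \<bullet> (t *\<^sub>R J \<alpha> + ?D (J \<alpha>)) = \<alpha> \<bullet> v" by (simp only: \<alpha>)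
  have 2: "J \<alpha> \<bullet> (t *\<^sub>R \<beta> + ?D \<beta>) = \<alpha> \<bullet> v" by (simp only: \<beta> Jv)
  have 3: "\<beta> \<bullet> (t *\<^sub>R J \<alpha> + ?D (J \<alpha>)) = \<alpha> \<bullet> v"
  proof -
    have "\<beta> \<bullet> (t *\<^sub>R J \<alpha> + ?D (J \<alpha>)) = (t *\<^sub>R \<beta> + ?D \<beta>) \<bullet> J \<alpha>"
      by (simp add: inner_add_right inner_add_left D.fcalc_sym)
    then show ?thesis by (simp add: \<beta> Jv inner_commute[of "J v"])
  qed
  have 4: "\<beta> \<bullet> (t *\<^sub>R \<beta> + ?D \<beta>) = \<beta> \<bullet> J v" by (simp only: \<beta>)
  have "t *\<^sub>R w + ?D w = (t *\<^sub>R J \<alpha> + ?D (J \<alpha>)) - (t *\<^sub>R \<beta> + ?D \<beta>)"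
    by (simp add: w linear_diff[OF D.linear_fcalc] scaleR_diff_right)
  then have "w \<bullet> (t *\<^sub>R w + ?D w) = \<beta> \<bullet> J v - \<alpha> \<bullet> v"
    by (simp only: w inner_diff_left inner_diff_right 1 2 3 4)
  moreover have "0 \<le> w \<bullet> ?D w"
    using D.fcalc_nonneg[of "\<lambda>t. t" w] a_pos by (simp add: less_imp_le inner_commute)
  ultimately have "t * (w \<bullet> w) \<le> \<beta> \<bullet> J v - \<alpha> \<bullet> v" by (simp add: inner_add_right)
  then show ?thesis
    by (simp add: w_def \<alpha>_def \<beta>_def inner_commute power2_norm_eq_inner)
qed

text \<open>The derivative of \<open>log_gap\<close> is the quadratic form bounded in the previous lemma, so that
  \<open>gap\<close> dominates the integral of \<open>t * (norm (resolvent_defect t))\<^sup>2\<close>.\<close>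

definition log_gap :: "real \<Rightarrow> real" where
  "log_gap t = J v \<bullet> D.fcalc (\<lambda>x. ln (t + x)) (J v) - v \<bullet> E.fcalc (\<lambda>x. ln (t + x)) v"

lemma log_gap_0: "log_gap 0 = - gap"
  by (simp add: log_gap_def gap_def)

lemma DERIV_log_gap:
  assumes "0 < t"
  shows "(log_gap has_real_derivative
    J v \<bullet> D.fcalc (\<lambda>x. 1 / (t + x)) (J v) - v \<bullet> E.fcalc (\<lambda>x. 1 / (t + x)) v) (at t)"
proof -
  have "t + a k > 0" "t + b l > 0" for k l
    using assms a_pos[of k] b_pos[of l] by auto
  then show ?thesis
    unfolding log_gap_def[abs_def] inner_commute[of "J v"] inner_commute[of v] D.inner_fcalc E.inner_fcalc
    by (auto intro!: derivative_eq_intros DERIV_sum simp: field_simps)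
qed

lemma continuous_on_log_gap: "continuous_on {0..T} log_gap"
proof -
  have "t + a k \<noteq> 0" "t + b l \<noteq> 0" if "t \<ge> 0" for k l t
    using that a_pos[of k] b_pos[of l] by auto
  then show ?thesis
    unfolding log_gap_def[abs_def] inner_commute[of "J v"] inner_commute[of v] D.inner_fcalc E.inner_fcalc
    by (intro continuous_intros) auto
qed

text \<open>Each quadratic form diverges like \<open>ln t\<close>. The spectral weights of
  \<open>J v\<close> and of \<open>v\<close> have the same total because \<open>J\<close> is
  isometric, so the divergent parts cancel.\<close>

lemma log_gap_tendsto: "(log_gap \<longlongrightarrow> 0) at_top"
proof -
  have *: "((\<lambda>t. ln (t + c) - ln t) \<longlongrightarrow> 0) at_top" if "0 < c" for c :: real
  proof -
    have "((\<lambda>t. ln (1 + c / t)) \<longlongrightarrow> ln (1 + 0)) at_top"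
      by (intro tendsto_intros real_tendsto_divide_at_top[OF tendsto_const filterlim_ident]) simp
    moreover have "\<forall>\<^sub>F t in at_top. ln (1 + c / t) = ln (t + c) - ln t"
      using eventually_gt_at_top[of 0]
    proof eventually_elim
      case (elim t)
      then have "1 + c / t = (t + c) / t" by (simp add: add_divide_distrib)
      then show ?case using elim that by (simp add: ln_div)
    qed
    ultimately show ?thesis by (simp add: tendsto_cong)
  qed
  let ?f = "\<lambda>t. (\<Sum>k\<in>UNIV. (ln (t + a k) - ln t) * (P k (J v) \<bullet> J v))
    - (\<Sum>l\<in>UNIV. (ln (t + b l) - ln t) * (Q l v \<bullet> v))"
  have "(?f \<longlongrightarrow> (\<Sum>k\<in>UNIV. 0 * (P k (J v) \<bullet> J v)) - (\<Sum>l\<in>UNIV. 0 * (Q l v \<bullet> v))) at_top"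
    by (intro tendsto_intros * a_pos b_pos)
  moreover have "?f t = log_gap t" for t
  proof -
    have "(\<Sum>k\<in>UNIV. ln t * (P k (J v) \<bullet> J v)) = (\<Sum>l\<in>UNIV. ln t * (Q l v \<bullet> v))"
      by (simp add: sum_distrib_left [symmetric] D.sum_inner_P E.sum_inner_P isometric v_in_S)
    then show ?thesis
      by (simp add: log_gap_def inner_commute[of "J v"] inner_commute[of v] D.inner_fcalc E.inner_fcalc
        left_diff_distrib sum_subtractf)
  qed
  ultimately show ?thesis by simp
qed

lemma log_gap_mono:
  assumes "0 \<le> s" "s \<le> t"
  shows "log_gap s \<le> log_gap t"
proof (rule DERIV_nonneg_imp_increasing_open[where f = log_gap])
  show "\<exists>y. (log_gap has_real_derivative y) (at x) \<and> 0 \<le> y" if "s < x" "x < t" for x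
  proof -
    have x: "0 < x" using assms that by simp
    then have "0 \<le> x * (norm (resolvent_defect x))\<^sup>2" by simp
    from order_trans[OF this norm_resolvent_defect_le[OF x]] show ?thesis
      using DERIV_log_gap[OF x] by blast
  qed
  show "continuous_on {s..t} log_gap"
    using assms by (intro continuous_on_subset[OF continuous_on_log_gap[of t]]) auto
qed (fact assms)

lemma log_gap_nonpos:
  assumes "0 \<le> t"
  shows "log_gap t \<le> 0"
proof (rule tendsto_lowerbound[OF log_gap_tendsto])
  show "\<forall>\<^sub>F s in at_top. log_gap t \<le> log_gap s"
    using assms by (intro eventually_at_top_linorderI[of t]) (rule log_gap_mono)
qed simp

lemma gap_nonneg: "0 \<le> gap"
  using log_gap_nonpos[of 0] by (simp add: log_gap_0)

section \<open>Comparison of the square roots\<close>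

definition sqrt_defect :: 'a where
  "sqrt_defect = D.fcalc sqrt (J v) - J (E.fcalc sqrt v)"

text \<open>\<open>sqrt_upto t x\<close> is the integral of $\sqrt s\,(1/s - 1/(s+x))$ over $0 \le s \le t$.\<close>

definition sqrt_upto :: "real \<Rightarrow> real \<Rightarrow> real" where
  "sqrt_upto t x = 2 * sqrt x * arctan (sqrt t / sqrt x)"

text \<open>Pairing with the fixed vector \<open>sqrt_defect\<close> replaces a vector-valued
  integral by a real function, to which monotonicity arguments apply. The price is one factor
  \<open>norm sqrt_defect\<close>, which is cancelled at the end.\<close>

definition sqrt_defect_upto :: "real \<Rightarrow> real" where
  "sqrt_defect_upto t = sqrt_defect \<bullet> (D.fcalc (sqrt_upto t) (J v) - J (E.fcalc (sqrt_upto t) v))"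

lemma sqrt_defect_upto_expand:
  "sqrt_defect \<bullet> (D.fcalc f (J v) - J (E.fcalc g v)) =
    (\<Sum>k\<in>UNIV. f (a k) * (sqrt_defect \<bullet> P k (J v))) - (\<Sum>l\<in>UNIV. g (b l) * (sqrt_defect \<bullet> J (Q l v)))"
  by (simp add: D.fcalc_def E.fcalc_def linear_sum[OF linear_J] linear_cmul[OF linear_J]
    inner_diff_right inner_sum_right)

lemma DERIV_sqrt_defect_upto:
  assumes t: "0 < t"
  shows "(sqrt_defect_upto has_real_derivative sqrt t * (sqrt_defect \<bullet> resolvent_defect t)) (at t)"
proof -
  let ?h = "\<lambda>x. sqrt t * (1 / t - 1 / (t + x))"
  have "(sqrt_defect_upto has_real_derivative
    sqrt_defect \<bullet> (D.fcalc ?h (J v) - J (E.fcalc ?h v))) (at t)"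
    unfolding sqrt_defect_upto_def[abs_def] sqrt_defect_upto_expand sqrt_upto_def
    by (intro DERIV_diff DERIV_sum DERIV_cmult_right DERIV_sqrt_arctan a_pos b_pos t)
  \<comment> \<open>The \<open>1 / t\<close> parts both yield \<open>(1 / t) *\<^sub>R J v\<close>
    and cancel, leaving the difference of resolvents.\<close>
  also have "D.fcalc ?h (J v) - J (E.fcalc ?h v) = sqrt t *\<^sub>R resolvent_defect t"
  proof -
    have D: "D.fcalc ?h x = sqrt t *\<^sub>R ((1 / t) *\<^sub>R x - D.fcalc (\<lambda>x. 1 / (t + x)) x)" for x
      by (simp only: D.fcalc_diff D.fcalc_cmul D.fcalc_const)
    have E: "E.fcalc ?h x = sqrt t *\<^sub>R ((1 / t) *\<^sub>R x - E.fcalc (\<lambda>x. 1 / (t + x)) x)" for x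
      by (simp only: E.fcalc_diff E.fcalc_cmul E.fcalc_const)
    show ?thesis
      by (simp add: D E linear_cmul[OF linear_J] linear_diff[OF linear_J] resolvent_defect_def
        scaleR_diff_right)
  qed
  finally show ?thesis by simp
qed

text \<open>This is the Cauchy-Schwarz bound by sqrt (T * gap) in linearised form: the inequality 2
  r \<le> \<mu> r^2 + 1 / \<mu> holds pointwise, so comparing derivatives suffices and no integral
  of a square has to be formed. The choice of \<mu> is left to the optimisation.\<close>

lemma sqrt_defect_upto_le:
  assumes T: "0 \<le> T" and \<mu>: "0 < \<mu>"
  shows "sqrt_defect_upto T \<le> norm sqrt_defect * (\<mu> * gap + T / \<mu>) / 2"
proof -
  let ?n = "norm sqrt_defect"
  let ?g = "\<lambda>t. J v \<bullet> D.fcalc (\<lambda>x. 1 / (t + x)) (J v) - v \<bullet> E.fcalc (\<lambda>x. 1 / (t + x)) v"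
  define F where "F t = ?n * (\<mu> * log_gap t + t / \<mu>) / 2 - sqrt_defect_upto t" for t
  have "F 0 \<le> F T"
  proof (rule DERIV_nonneg_imp_increasing_open[OF T])
    fix t assume t: "0 < t" "t < T"
    have "(F has_real_derivative
      ?n * (\<mu> * ?g t + 1 / \<mu>) / 2 - sqrt t * (sqrt_defect \<bullet> resolvent_defect t)) (at t)"
      unfolding F_def[abs_def] using \<mu>
      by (auto intro!: derivative_eq_intros DERIV_log_gap DERIV_sqrt_defect_upto t)
    moreover have "sqrt t * (sqrt_defect \<bullet> resolvent_defect t) \<le> ?n * (\<mu> * ?g t + 1 / \<mu>) / 2"
    proof -
      let ?w = "sqrt t * norm (resolvent_defect t)"
      have "sqrt t * (sqrt_defect \<bullet> resolvent_defect t) \<le> ?n * ?w"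
        using mult_left_mono[OF norm_cauchy_schwarz[of sqrt_defect "resolvent_defect t"], of "sqrt t"] t
        by (simp add: mult.left_commute)
      also have "?w \<le> (\<mu> * ?w\<^sup>2 + 1 / \<mu>) / 2"
      proof -
        have "0 \<le> (\<mu> * ?w - 1)\<^sup>2 / \<mu>" using \<mu> by simp
        also have "(\<mu> * r - 1)\<^sup>2 / \<mu> = \<mu> * r\<^sup>2 + 1 / \<mu> - 2 * r" for r
          using \<mu> by (simp add: power2_eq_square field_simps)
        finally show ?thesis by simp
      qed
      also have "?w\<^sup>2 \<le> ?g t"
        using norm_resolvent_defect_le[of t] t by (simp add: power_mult_distrib)
      finally show ?thesis using \<mu> by (simp add: mult_left_mono divide_right_mono)
    qed
    ultimately show "\<exists>y. (F has_real_derivative y) (at t) \<and> 0 \<le> y" by auto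
  next
    \<comment> \<open>The derivatives are available only for t > 0, so the endpoint 0 enters through
      continuity.\<close>
    have "sqrt (a k) \<noteq> 0" "sqrt (b l) \<noteq> 0" for k l using a_pos[of k] b_pos[of l] by auto
    then have "continuous_on {0..T} sqrt_defect_upto"
      unfolding sqrt_defect_upto_def[abs_def] sqrt_defect_upto_expand sqrt_upto_def
      by (intro continuous_intros) auto
    then show "continuous_on {0..T} F"
      unfolding F_def[abs_def] using \<mu> by (intro continuous_intros continuous_on_log_gap) auto
  qed
  moreover have "sqrt_defect_upto 0 = 0"
    by (simp add: sqrt_defect_upto_def sqrt_upto_def[abs_def] D.fcalc_const E.fcalc_const linear_0[OF linear_J])
  ultimately have "sqrt_defect_upto T \<le> ?n * (\<mu> * (log_gap T + gap) + T / \<mu>) / 2"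
    by (simp add: F_def log_gap_0 algebra_simps add_divide_distrib)
  also have "\<dots> \<le> ?n * (\<mu> * gap + T / \<mu>) / 2"
    using log_gap_nonpos[OF T] \<mu> by (intro divide_right_mono mult_left_mono add_right_mono) auto
  finally show ?thesis .
qed

text \<open>The part of the integral beyond \<open>T\<close> is at most 2 x / sqrt T on the
  spectrum. Being linear in x, it is controlled by the operator itself, hence by \<open>K\<close>;
  the two operators together give the factor 4.\<close>

lemma norm_sqrt_defect_le:
  assumes T: "0 < T" and \<mu>: "0 < \<mu>" and K: "norm (D.fcalc (\<lambda>t. t) (J v)) \<le> K"
  shows "pi * norm sqrt_defect \<le> (\<mu> * gap + T / \<mu>) / 2 + 4 * K / sqrt T"
proof -
  let ?n = "norm sqrt_defect"
  \<comment> \<open>This is the integral over s > T, rewritten through the complementary angle so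
    that the argument of arctan becomes small for large \<open>T\<close>.\<close>
  define tail where "tail x = 2 * sqrt x * arctan (sqrt x / sqrt T)" for x
  have split: "pi * sqrt x = sqrt_upto T x + tail x" if "0 < x" for x
  proof -
    have "sqrt_upto T x + tail x = 2 * sqrt x * (arctan (sqrt T / sqrt x) + arctan (sqrt x / sqrt T))"
      by (simp add: sqrt_upto_def tail_def distrib_left)
    then show ?thesis using arctan_sqrt_reflect[OF that T] by simp
  qed
  have tail: "\<bar>tail x\<bar> \<le> \<bar>2 / sqrt T * x\<bar>" if "0 < x" for x
  proof -
    have "tail x \<le> 2 * sqrt x * (sqrt x / sqrt T)"
      unfolding tail_def using that T by (intro mult_left_mono arctan_le_self) auto
    then show ?thesis using that T by (simp add: tail_def mult.assoc)
  qed
  have D: "pi *\<^sub>R D.fcalc sqrt x = D.fcalc (sqrt_upto T) x + D.fcalc tail x" for x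
    unfolding D.fcalc_add [symmetric] D.fcalc_cmul [symmetric]
    by (rule D.fcalc_cong) (simp add: split a_pos)
  have E: "pi *\<^sub>R E.fcalc sqrt x = E.fcalc (sqrt_upto T) x + E.fcalc tail x" for x
    unfolding E.fcalc_add [symmetric] E.fcalc_cmul [symmetric]
    by (rule E.fcalc_cong) (simp add: split b_pos)
  have "norm (D.fcalc tail (J v)) \<le> norm (D.fcalc (\<lambda>x. 2 / sqrt T * x) (J v))"
    by (rule D.norm_fcalc_mono) (rule tail[OF a_pos])
  also have "\<dots> \<le> 2 / sqrt T * K"
    unfolding D.fcalc_cmul using T K by (simp add: divide_right_mono)
  finally have nD: "norm (D.fcalc tail (J v)) \<le> 2 / sqrt T * K" .
  have "norm (J (E.fcalc tail v)) \<le> norm (E.fcalc (\<lambda>x. 2 / sqrt T * x) v)"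
    unfolding norm_J[OF E_fcalc_in_S] by (rule E.norm_fcalc_mono) (rule tail[OF b_pos])
  also have "\<dots> \<le> 2 / sqrt T * K"
    unfolding E.fcalc_cmul using T order_trans[OF norm_E_v_le K] by (simp add: divide_right_mono)
  finally have nE: "norm (J (E.fcalc tail v)) \<le> 2 / sqrt T * K" .
  have "pi *\<^sub>R sqrt_defect = pi *\<^sub>R D.fcalc sqrt (J v) - J (pi *\<^sub>R E.fcalc sqrt v)"
    by (simp add: sqrt_defect_def scaleR_diff_right linear_cmul[OF linear_J])
  also have "\<dots> = (D.fcalc (sqrt_upto T) (J v) - J (E.fcalc (sqrt_upto T) v))
      + (D.fcalc tail (J v) - J (E.fcalc tail v))"
    by (simp add: D E linear_add[OF linear_J])
  finally have "sqrt_defect \<bullet> (pi *\<^sub>R sqrt_defect) = sqrt_defect_upto T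
      + sqrt_defect \<bullet> (D.fcalc tail (J v) - J (E.fcalc tail v))"
    by (simp add: sqrt_defect_upto_def inner_add_right)
  also have "\<dots> \<le> ?n * (\<mu> * gap + T / \<mu>) / 2 + ?n * (4 * K / sqrt T)"
  proof (intro add_mono sqrt_defect_upto_le)
    have "norm (D.fcalc tail (J v) - J (E.fcalc tail v)) \<le> 4 * K / sqrt T"
      using norm_triangle_ineq4[of "D.fcalc tail (J v)" "J (E.fcalc tail v)"] nD nE by simp
    then show "sqrt_defect \<bullet> (D.fcalc tail (J v) - J (E.fcalc tail v)) \<le> ?n * (4 * K / sqrt T)"
      by (intro order_trans[OF norm_cauchy_schwarz] mult_left_mono) auto
  qed (use T \<mu> in auto)
  finally have *: "?n * (pi * ?n) \<le> ?n * ((\<mu> * gap + T / \<mu>) / 2 + 4 * K / sqrt T)"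
    by (simp add: power2_norm_eq_inner [symmetric] power2_eq_square algebra_simps)
  show ?thesis
  \<comment> \<open>Pairing \<open>sqrt_defect\<close> with itself left a common factor
    \<open>?n\<close>. It cancels unless it vanishes, and then only the sign of the right-hand side
    matters.\<close>
  proof (cases "?n = 0")
    case True
    then show ?thesis
      using T \<mu> gap_nonneg order_trans[OF norm_ge_zero K] by simp
  next
    case False
    then show ?thesis using * by simp
  qed
qed

lemma sqrt_defect_bound:
  assumes K: "norm (D.fcalc (\<lambda>t. t) (J v)) \<le> K" and "0 < K"
  shows "(pi / 4) ^ 4 * norm sqrt_defect ^ 4 / K\<^sup>2 \<le> gap"
\<comment> \<open>\<open>gap\<close> may be 0, where the optimal \<mu> would be infinite. Any
  \<open>e\<close> above \<open>gap\<close> is positive and can be used in its place.\<close>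
proof (rule dense_ge)
  fix e assume "gap < e"
  then have e: "0 < e" using gap_nonneg by simp
  define q where "q = sqrt (sqrt e)"
  define k where "k = sqrt K"
  have "q ^ 4 = (q\<^sup>2)\<^sup>2" by simp
  then have q: "0 < q" "q ^ 4 = e" using e by (auto simp: q_def)
  have k: "0 < k" "k\<^sup>2 = K" using \<open>0 < K\<close> by (auto simp: k_def)
  text \<open>These values of \<open>T\<close> and \<open>\<mu>\<close> minimise the right-hand side of the previous bound,
    with \<open>e\<close> in place of \<open>gap\<close>.\<close>
  define T where "T = (2 * k / q)\<^sup>2"
  define \<mu> where "\<mu> = 2 * k / q ^ 3"
  have T: "0 < T" "sqrt T = 2 * k / q" using q k by (auto simp: T_def)
  have \<mu>: "0 < \<mu>" using q k by (simp add: \<mu>_def)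
  have "pi * norm sqrt_defect \<le> (\<mu> * gap + T / \<mu>) / 2 + 4 * K / sqrt T"
    by (rule norm_sqrt_defect_le[OF T(1) \<mu> K])
  also have "\<dots> \<le> (\<mu> * e + T / \<mu>) / 2 + 4 * K / sqrt T"
    using \<mu> \<open>gap < e\<close> by simp
  \<comment> \<open>The three terms contribute k q, k q and 2 k q; their sum is the source of the 4
    in pi / 4.\<close>
  also have "\<dots> = 4 * (k * q)"
  proof -
    have "\<mu> * e = 2 * k * q" using q k unfolding q(2)[symmetric] \<mu>_def
      by (simp add: power4_eq_xxxx power3_eq_cube)
    moreover have "T / \<mu> = 2 * k * q" using q(1) k(1) unfolding T_def \<mu>_def
      by (simp add: power2_eq_square power3_eq_cube)
    moreover have "4 * K / sqrt T = 2 * k * q" using q(1) k(1) unfolding T(2)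
      by (simp add: k(2) [symmetric] power2_eq_square)
    ultimately show ?thesis by simp
  qed
  finally have "pi / 4 * norm sqrt_defect \<le> k * q" by simp
  then have "(pi / 4 * norm sqrt_defect) ^ 4 \<le> (k * q) ^ 4"
    by (rule power_mono) simp
  also have "\<dots> = K\<^sup>2 * e"
    unfolding power_mult_distrib q(2) k(2)[symmetric] by (simp add: power_mult [symmetric])
  finally show "(pi / 4) ^ 4 * norm sqrt_defect ^ 4 / K\<^sup>2 \<le> e"
    using \<open>0 < K\<close> by (simp add: power_mult_distrib power_divide divide_le_eq mult.commute)
qed

end

section \<open>Sandwich operators on matrices\<close>

lemma adj_nth [simp]: "adj A $ i $ j = cnj (A $ j $ i)"
  by (simp add: adj_def transpose_def)

lemma adj_adj [simp]: "adj (adj A) = A"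
  by (simp add: vec_eq_iff)

lemma adj_mult: "adj (A ** B) = adj B ** adj A"
  by (simp add: vec_eq_iff matrix_matrix_mult_def mult.commute)

text \<open>The real inner product already carried by nested vectors is the real part of the
  Hilbert-Schmidt product, so matrices fit the abstract real setting directly.\<close>

lemma inner_matrix: "X \<bullet> Y = Re (trace (adj X ** Y))" for X Y :: "complex^'n^'n"
proof -
  have "X \<bullet> Y = (\<Sum>i\<in>UNIV. \<Sum>j\<in>UNIV. Re (cnj (X $ i $ j) * Y $ i $ j))"
    by (simp add: inner_vec_def inner_complex_def)
  also have "\<dots> = Re (trace (adj X ** Y))"
    by (subst sum.swap) (simp add: trace_def matrix_matrix_mult_def)
  finally show ?thesis .
qed

lemma norm_matrix: "norm X = hs_norm X"
  by (simp add: norm_eq_sqrt_inner hs_norm_def hs_inner_def inner_matrix)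

lemma inner_mult_left: "(A ** X) \<bullet> Y = X \<bullet> (adj A ** Y)" for X Y :: "complex^'n^'n"
  by (simp add: inner_matrix adj_mult matrix_mul_assoc)

lemma inner_mult_right: "(X ** A) \<bullet> Y = X \<bullet> (Y ** adj A)" for X Y :: "complex^'n^'n"
proof -
  have "trace (adj A ** (adj X ** Y)) = trace ((adj X ** Y) ** adj A)"
    by (rule trace_mul_sym)
  then show ?thesis by (simp add: inner_matrix adj_mult matrix_mul_assoc)
qed

lemma inner_adj: "adj X \<bullet> adj Y = X \<bullet> Y" for X Y :: "complex^'n^'n"
proof -
  have "trace (adj X ** Y) = cnj (trace (adj Y ** X))"
    by (simp add: trace_def matrix_matrix_mult_def mult.commute)
  then have "Re (trace (adj X ** Y)) = Re (trace (X ** adj Y))"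
    using trace_mul_sym[of X "adj Y"] by simp
  then show ?thesis by (simp add: inner_matrix)
qed

lemma matrix_mult_scaleR_left: "(c *\<^sub>R A) ** B = c *\<^sub>R (A ** B)"
  for A :: "complex^'n^'m" and B :: "complex^'p^'n"
  by (simp add: vec_eq_iff matrix_matrix_mult_def scaleR_right.sum)

lemma matrix_mult_scaleR_right: "A ** (c *\<^sub>R B) = c *\<^sub>R (A ** B)"
  for A :: "complex^'n^'m" and B :: "complex^'p^'n"
  by (simp add: vec_eq_iff matrix_matrix_mult_def scaleR_right.sum)

lemma linear_matrix_mult_left: "linear (\<lambda>X. A ** X)" for A :: "complex^'n^'m"
  by (rule linearI) (simp_all add: matrix_add_ldistrib matrix_mult_scaleR_right)

lemma linear_matrix_mult_right: "linear (\<lambda>X. X ** A)" for A :: "complex^'n^'m"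
proof (rule linearI)
  show "(X + Y) ** A = X ** A + Y ** A" for X Y :: "complex^'m^'p"
    by (simp add: vec_eq_iff matrix_matrix_mult_def distrib_right sum.distrib)
qed (simp add: matrix_mult_scaleR_left)

lemma linear_matrix_sandwich: "linear (\<lambda>X. A ** X ** B)"
  for A :: "complex^'n^'m" and B :: "complex^'p^'q"
  using linear_compose[OF linear_matrix_mult_left[of A] linear_matrix_mult_right[of B]]
  by (simp add: o_def)

section \<open>Diagonalised matrices and two-sided spectral projections\<close>

lemma real_diag_mult: "real_diag f ** real_diag g = real_diag (\<lambda>i. f i * g i)"
proof -
  have "(real_diag f ** real_diag g) $ i $ j = real_diag (\<lambda>i. f i * g i) $ i $ j" for i j :: 'a
  proof -
    have "(real_diag f ** real_diag g) $ i $ j =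
      (\<Sum>k\<in>UNIV. if k = i then (if i = j then complex_of_real (f i * g i) else 0) else 0)"
      by (simp only: matrix_matrix_mult_def real_diag_def vec_lambda_beta) (rule sum.cong, auto)
    then show ?thesis by (simp add: real_diag_def)
  qed
  then show ?thesis by (simp add: vec_eq_iff)
qed

lemma adj_real_diag: "adj (real_diag f) = real_diag f"
  by (auto simp: vec_eq_iff real_diag_def)

lemma real_diag_1: "real_diag (\<lambda>i. 1) = mat 1"
  by (simp add: vec_eq_iff real_diag_def mat_def)

definition spec :: "complex^'n^'n \<Rightarrow> ('n \<Rightarrow> real) \<Rightarrow> complex^'n^'n" where
  "spec U d = U ** real_diag d ** adj U"

lemma spec_mult:
  assumes "unitary_mat U"
  shows "spec U f ** spec U g = spec U (\<lambda>i. f i * g i)"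
proof -
  have "spec U f ** spec U g = U ** real_diag f ** (adj U ** U) ** real_diag g ** adj U"
    by (simp add: spec_def matrix_mul_assoc)
  also have "\<dots> = U ** (real_diag f ** real_diag g) ** adj U"
    using assms by (simp add: unitary_mat_def matrix_mul_assoc)
  finally show ?thesis by (simp add: real_diag_mult spec_def)
qed

lemma adj_spec [simp]: "adj (spec U f) = spec U f"
  by (simp add: spec_def adj_mult adj_real_diag matrix_mul_assoc)

lemma spec_1: "unitary_mat U \<Longrightarrow> spec U (\<lambda>i. 1) = mat 1"
  by (simp add: spec_def real_diag_1 unitary_mat_def)

abbreviation proj :: "'n \<Rightarrow> 'n \<Rightarrow> real" where
  "proj i \<equiv> (\<lambda>j. if j = i then 1 else 0)"

lemma sum_spec_proj: "(\<Sum>i\<in>UNIV. f i *\<^sub>R spec U (proj i)) = spec U f"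
proof -
  have "real_diag f = (\<Sum>i\<in>UNIV. f i *\<^sub>R real_diag (proj i))"
  proof -
    have "(\<Sum>i\<in>UNIV. f i *\<^sub>R real_diag (proj i)) $ k $ l =
      (\<Sum>i\<in>UNIV. if i = k then (if k = l then complex_of_real (f i) else 0) else 0)" for k l :: 'a
      unfolding sum_component by (intro sum.cong) (auto simp: real_diag_def scaleR_conv_of_real [of _ "_ :: complex"])
    then show ?thesis by (simp add: vec_eq_iff real_diag_def)
  qed
  then show ?thesis
    by (simp add: spec_def linear_sum[OF linear_matrix_sandwich] linear_cmul[OF linear_matrix_sandwich])
qed

text \<open>These are the joint spectral projections of left multiplication by a matrix diagonal in
  \<open>V\<close> and right multiplication by one diagonal in \<open>U\<close>. The two
  multiplications commute even when the matrices do not.\<close>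

definition sandwich ::
  "complex^'n^'n \<Rightarrow> complex^'n^'n \<Rightarrow> 'n \<times> 'n \<Rightarrow> complex^'n^'n \<Rightarrow> complex^'n^'n" where
  "sandwich V U k X = spec V (proj (fst k)) ** X ** spec U (proj (snd k))"

text \<open>Functions that factor over the two indices become two-sided multiplications. The
  identity and the square root of a quotient of eigenvalues factor; the logarithm is a difference of
  two such terms.\<close>

lemma sum_sandwich:
  "(\<Sum>k\<in>UNIV. (g (fst k) * h (snd k)) *\<^sub>R sandwich V U k X) = spec V g ** X ** spec U h"
proof -
  have "(\<Sum>k\<in>UNIV. (g (fst k) * h (snd k)) *\<^sub>R sandwich V U k X) =
    (\<Sum>i\<in>UNIV. \<Sum>j\<in>UNIV. (g i * h j) *\<^sub>R (spec V (proj i) ** X ** spec U (proj j)))"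
    unfolding sum.cartesian_product UNIV_Times_UNIV by (simp add: sandwich_def case_prod_beta)
  also have "\<dots> = (\<Sum>i\<in>UNIV. g i *\<^sub>R (spec V (proj i) ** X ** spec U h))"
    unfolding sum_spec_proj[of h U, symmetric]
    by (simp add: linear_sum[OF linear_matrix_mult_left] linear_cmul[OF linear_matrix_mult_left]
      scaleR_right.sum)
  also have "\<dots> = spec V g ** X ** spec U h"
    unfolding sum_spec_proj[of g V, symmetric] matrix_mul_assoc [symmetric]
    by (simp add: linear_sum[OF linear_matrix_mult_right] linear_cmul[OF linear_matrix_mult_right])
  finally show ?thesis .
qed

lemma spec_proj_mult:
  assumes "unitary_mat U"
  shows "spec U (proj i) ** spec U (proj j) = (if i = j then spec U (proj i) else 0)"
proof -
  have 0: "spec U (\<lambda>i. 0) = 0"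
    using sum_spec_proj[of "\<lambda>i. 0" U] by (simp only: scaleR_zero_left sum.neutral_const)
  have "(\<lambda>m. proj i m * proj j m) = (if i = j then proj i else (\<lambda>m. 0))"
    by (rule ext) simp
  then show ?thesis
    unfolding spec_mult[OF assms] by (simp only: 0 split: if_split) blast
qed

lemma sandwich_sym: "sandwich V U k X \<bullet> Y = X \<bullet> sandwich V U k Y"
proof -
  let ?V = "spec V (proj (fst k))" and ?U = "spec U (proj (snd k))"
  have "sandwich V U k X \<bullet> Y = (?V ** (X ** ?U)) \<bullet> Y"
    by (simp only: sandwich_def matrix_mul_assoc)
  also have "\<dots> = (X ** ?U) \<bullet> (?V ** Y)"
    by (simp only: inner_mult_left[of ?V] adj_spec)
  also have "\<dots> = X \<bullet> (?V ** Y ** ?U)"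
    by (simp only: inner_mult_right[of X] adj_spec)
  finally show ?thesis by (simp only: sandwich_def)
qed

lemma sandwich_sandwich:
  assumes "unitary_mat V" "unitary_mat U"
  shows "sandwich V U k (sandwich V U l X) = (if k = l then sandwich V U k X else 0)"
proof -
  have "sandwich V U k (sandwich V U l X) =
    (spec V (proj (fst k)) ** spec V (proj (fst l))) ** X **
    (spec U (proj (snd l)) ** spec U (proj (snd k)))"
    by (simp only: sandwich_def matrix_mul_assoc)
  then show ?thesis
    unfolding spec_proj_mult[OF assms(1)] spec_proj_mult[OF assms(2)]
    by (cases k; cases l) (simp add: sandwich_def)
qed

lemma sum_sandwich_1:
  assumes "unitary_mat V" "unitary_mat U"
  shows "(\<Sum>k\<in>UNIV. sandwich V U k X) = X"
  using sum_sandwich[of "\<lambda>i. 1" "\<lambda>i. 1" V U X] assms by (simp add: spec_1)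

lemma linear_sandwich: "linear (sandwich V U k)"
  unfolding sandwich_def[abs_def] by (rule linear_matrix_sandwich)

lemma spectral_operator_sandwich:
  assumes "unitary_mat V" "unitary_mat U"
  shows "spectral_operator (sandwich V U)"
  by (rule spectral_operator.intro)
    (rule linear_sandwich sandwich_sym sandwich_sandwich[OF assms] sum_sandwich_1[OF assms])+

section \<open>The spectral theorem for Hermitian matrices\<close>

text \<open>A maximiser of the Rayleigh quotient on the unit sphere of \<open>W\<close> is an
  eigenvector: moving it by s along its residual \<open>z\<close> would gain to first order in s and
  lose only to second order, unless \<open>z\<close> is 0.\<close>

lemma symmetric_eigenvector_exists:
  fixes T :: "'a::euclidean_space \<Rightarrow> 'a"
  assumes T: "linear T" and sym: "\<And>x y. T x \<bullet> y = x \<bullet> T y"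
    and W: "subspace W" and inv: "\<And>x. x \<in> W \<Longrightarrow> T x \<in> W"
    and w: "w \<in> W" "w \<noteq> 0"
  obtains x c where "x \<in> W" "norm x = 1" "T x = c *\<^sub>R x"
proof -
  have "compact (W \<inter> sphere 0 1)"
    by (intro closed_Int_compact closed_subspace W compact_sphere)
  moreover have "w /\<^sub>R norm w \<in> W \<inter> sphere 0 1"
    using w W by (simp add: subspace_scale)
  moreover have "continuous_on (W \<inter> sphere 0 1) (\<lambda>x. x \<bullet> T x)"
    by (intro continuous_intros linear_continuous_on linear_conv_bounded_linear[THEN iffD1] T)
  ultimately obtain x where x: "x \<in> W" "norm x = 1"
    and max: "\<And>y. y \<in> W \<Longrightarrow> norm y = 1 \<Longrightarrow> y \<bullet> T y \<le> x \<bullet> T x"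
    using continuous_attains_sup[of "W \<inter> sphere 0 1" "\<lambda>x. x \<bullet> T x"] by fastforce
  define c where "c = x \<bullet> T x"
  have le: "y \<bullet> T y \<le> c * (y \<bullet> y)" if "y \<in> W" for y
  proof (cases "y = 0")
    case False
    have "(y /\<^sub>R norm y) \<bullet> T (y /\<^sub>R norm y) \<le> c"
      unfolding c_def using that False W by (intro max) (auto simp: subspace_scale)
    then show ?thesis
      using False by (simp add: linear_cmul[OF T] dot_square_norm power2_eq_square field_simps)
  qed simp
  define z where "z = T x - c *\<^sub>R x"
  define C where "C = c * (z \<bullet> z) - z \<bullet> T z"
  have z: "z \<in> W" unfolding z_def using x inv W by (intro subspace_diff subspace_scale) auto
  have C: "0 \<le> C" using le[OF z] by (simp add: C_def)
  have bound: "2 * s * (z \<bullet> z) \<le> s\<^sup>2 * C" for s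
  proof -
    have "(x + s *\<^sub>R z) \<bullet> T (x + s *\<^sub>R z) \<le> c * ((x + s *\<^sub>R z) \<bullet> (x + s *\<^sub>R z))"
      using x z W by (intro le subspace_add subspace_scale)
    moreover have "x \<bullet> T z = z \<bullet> T x" using sym[of x z] by (metis inner_commute)
    moreover have "z \<bullet> T x = z \<bullet> z + c * (x \<bullet> z)"
      by (simp add: z_def inner_diff_right inner_diff_left algebra_simps inner_commute)
    moreover have "x \<bullet> x = 1" using x by (simp add: dot_square_norm)
    ultimately show ?thesis
      by (simp add: C_def linear_add[OF T] linear_cmul[OF T] inner_add_left inner_add_right
        c_def[symmetric] inner_commute[of z x] power2_eq_square algebra_simps)
  qed
  have "z \<bullet> z = 0"
  proof (rule ccontr)
    assume "z \<bullet> z \<noteq> 0"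
    then have n: "0 < z \<bullet> z" by (simp add: order_less_le)
    have "2 * (z \<bullet> z) \<le> s * C" if "0 < s" for s
      using bound[of s] that by (simp add: power2_eq_square)
    \<comment> \<open>The denominator \<open>C + 1\<close> makes the step size admissible also when
      \<open>C\<close> is 0.\<close>
    from this[of "(z \<bullet> z) / (C + 1)"] have "2 * (z \<bullet> z) \<le> (z \<bullet> z) * (C / (C + 1))"
      using n C by simp
    also have "\<dots> \<le> (z \<bullet> z) * 1" using n C by (intro mult_left_mono) auto
    finally show False using n by simp
  qed
  then have "T x = c *\<^sub>R x" by (simp add: z_def)
  with x show thesis by (rule that)
qed

section \<open>Complex orthonormal eigenbases\<close>

definition cinner :: "complex^'n \<Rightarrow> complex^'n \<Rightarrow> complex" where
  "cinner x y = (\<Sum>i\<in>UNIV. cnj (x $ i) * y $ i)"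

lemma Re_cinner: "Re (cinner x y) = x \<bullet> y"
  by (simp add: cinner_def inner_vec_def inner_complex_def)

lemma cnj_cinner: "cnj (cinner x y) = cinner y x"
  by (simp add: cinner_def mult.commute)

lemma Im_cinner: "Im (cinner x y) = (\<i> *s x) \<bullet> y"
  by (simp add: cinner_def inner_vec_def inner_complex_def algebra_simps)

lemma cinner_self: "cinner x x = of_real ((norm x)\<^sup>2)"
proof (rule complex_eqI)
  show "Im (cinner x x) = Im (of_real ((norm x)\<^sup>2))"
    using arg_cong[OF cnj_cinner[of x x], of Im] by simp
qed (simp add: Re_cinner power2_norm_eq_inner)

lemma cinner_mult_vec: "cinner x (A *v y) = cinner (adj A *v x) y"
proof -
  have "cinner x (A *v y) = (\<Sum>i\<in>UNIV. \<Sum>j\<in>UNIV. cnj (x $ i) * (A $ i $ j * y $ j))"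
    by (simp add: cinner_def matrix_vector_mult_def sum_distrib_left)
  also have "\<dots> = cinner (adj A *v x) y"
    by (subst sum.swap) (simp add: cinner_def matrix_vector_mult_def sum_distrib_left mult_ac)
  finally show ?thesis .
qed

text \<open>The complex orthogonal complement of eigenvectors of a Hermitian matrix is invariant, so
  the next eigenvector can be sought inside it.\<close>

lemma orthonormal_eigenvectors_exist:
  fixes A :: "complex^'n^'n"
  assumes A: "adj A = A" and "m \<le> CARD('n)"
  shows "\<exists>B. finite B \<and> card B = m \<and> (\<forall>b\<in>B. \<exists>c. A *v b = c *\<^sub>R b) \<and>
    (\<forall>b\<in>B. \<forall>b'\<in>B. cinner b b' = (if b = b' then 1 else 0))"
  using assms(2)
proof (induction m)
  case 0
  then show ?case by (intro exI[of _ "{}"]) simp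
next
  case (Suc m)
  then obtain B where B: "finite B" "card B = m"
    and eig: "\<And>b. b \<in> B \<Longrightarrow> \<exists>c. A *v b = c *\<^sub>R b"
    and orth: "\<And>b b'. b \<in> B \<Longrightarrow> b' \<in> B \<Longrightarrow> cinner b b' = (if b = b' then 1 else 0)"
    by auto
  define W where "W = {x. \<forall>b\<in>B. cinner b x = 0}"
  have W: "subspace W"
    unfolding subspace_def W_def
    by (auto simp: cinner_def distrib_left sum.distrib scaleR_right.sum [symmetric])
  have inv: "A *v x \<in> W" if "x \<in> W" for x
  proof -
    have "cinner b (A *v x) = 0" if "b \<in> B" for b
    proof -
      obtain c where "A *v b = c *\<^sub>R b" using eig[OF \<open>b \<in> B\<close>] by blast
      then have "cinner b (A *v x) = c *\<^sub>R cinner b x"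
        by (simp add: cinner_mult_vec A) (simp add: cinner_def scaleR_right.sum)
      then show ?thesis using \<open>x \<in> W\<close> \<open>b \<in> B\<close> by (simp add: W_def)
    qed
    then show ?thesis by (simp add: W_def)
  qed
  \<comment> \<open>Complex orthogonality to m vectors is real orthogonality to these vectors and
    their multiples by \<i>. These 2 m conditions leave a nonzero solution because the real
    dimension is twice the complex one.\<close>
  have "dim (B \<union> (\<lambda>b. \<i> *s b) ` B) \<le> card (B \<union> (\<lambda>b. \<i> *s b) ` B)"
    using B by (intro dim_le_card') simp
  also have "\<dots> \<le> card B + card ((\<lambda>b. \<i> *s b) ` B)" by (rule card_Un_le)
  also have "\<dots> \<le> m + m" using B card_image_le[of B] by (intro add_mono) auto
  also have "\<dots> < DIM(complex^'n)" using Suc.prems by simp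
  finally obtain w where w: "w \<noteq> 0"
    and wo: "\<And>y. y \<in> span (B \<union> (\<lambda>b. \<i> *s b) ` B) \<Longrightarrow> orthogonal w y"
    by (rule orthogonal_to_subspace_exists) blast
  have "w \<in> W"
  proof -
    have "cinner b w = 0" if "b \<in> B" for b
    proof (rule complex_eqI)
      show "Re (cinner b w) = Re 0" "Im (cinner b w) = Im 0"
        using that wo[of b] wo[of "\<i> *s b"]
        by (auto simp: Re_cinner Im_cinner orthogonal_def inner_commute span_base)
    qed
    then show ?thesis by (simp add: W_def)
  qed
  moreover have "linear ((*v) A)" by (rule matrix_vector_mul_linear)
  moreover have "(A *v x) \<bullet> y = x \<bullet> (A *v y)" for x y
    by (simp add: Re_cinner [symmetric] cinner_mult_vec A)
  ultimately obtain x c where x: "x \<in> W" "norm x = 1" "A *v x = c *\<^sub>R x"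
    using symmetric_eigenvector_exists[of "(*v) A" W w] W inv w by blast
  have xx: "cinner x x = 1" using x by (simp add: cinner_self)
  have bx: "cinner b x = 0" "cinner x b = 0" if "b \<in> B" for b
    using x that cnj_cinner[of b x] by (auto simp: W_def)
  have "x \<notin> B" using bx(1)[of x] xx by auto
  then show ?case
    using B eig orth x xx bx by (intro exI[of _ "insert x B"]) auto
qed

lemma hermitian_diagonalizable:
  fixes A :: "complex^'n^'n"
  assumes A: "adj A = A"
  obtains U d where "unitary_mat U" "A = spec U d"
proof -
  obtain B where B: "finite B" "card B = CARD('n)"
    and eig: "\<And>b. b \<in> B \<Longrightarrow> \<exists>c. A *v b = c *\<^sub>R b"
    and orth: "\<And>b b'. b \<in> B \<Longrightarrow> b' \<in> B \<Longrightarrow> cinner b b' = (if b = b' then 1 else 0)"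
    using orthonormal_eigenvectors_exist[OF A, of "CARD('n)"] by auto
  obtain u where u: "bij_betw u (UNIV :: 'n set) B"
    using finite_same_card_bij[of "UNIV :: 'n set" B] B by auto
  have uB: "u i \<in> B" for i using u by (auto simp: bij_betw_def)
  have u_eq: "u i = u j \<longleftrightarrow> i = j" for i j using u by (auto simp: bij_betw_def inj_on_def)
  define d where "d i = (SOME c. A *v u i = c *\<^sub>R u i)" for i
  have d: "A *v u i = d i *\<^sub>R u i" for i
    unfolding d_def by (rule someI_ex) (rule eig[OF uB])
  define U :: "complex^'n^'n" where "U = (\<chi> i j. u j $ i)"
  have "(adj U ** U) $ i $ j = cinner (u i) (u j)" for i j
    by (simp add: matrix_matrix_mult_def U_def cinner_def)
  then have "adj U ** U = mat 1"
    unfolding orth[OF uB uB] u_eq by (simp add: vec_eq_iff mat_def)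
  then have U: "unitary_mat U"
    by (simp add: unitary_mat_def matrix_left_right_inverse)
  have "A ** U = U ** real_diag d"
  proof -
    have "(A ** U) $ i $ j = (U ** real_diag d) $ i $ j" for i j
    proof -
      have "(A ** U) $ i $ j = (A *v u j) $ i"
        by (simp add: matrix_matrix_mult_def matrix_vector_mult_def U_def)
      also have "\<dots> = of_real (d j) * u j $ i" by (simp add: d) (simp add: scaleR_conv_of_real)
      also have "\<dots> = (\<Sum>k\<in>UNIV. if k = j then of_real (d j) * u j $ i else 0)" by simp
      also have "\<dots> = (U ** real_diag d) $ i $ j"
        by (simp only: matrix_matrix_mult_def real_diag_def U_def vec_lambda_beta) (rule sum.cong, auto)
      finally show ?thesis .
    qed
    then show ?thesis by (simp add: vec_eq_iff)
  qed
  then have "A ** (U ** adj U) = spec U d"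
    by (simp add: spec_def matrix_mul_assoc)
  then have "A = spec U d" using U by (simp add: unitary_mat_def)
  with U show thesis by (rule that)
qed

text \<open>The change of basis \<open>W\<close> intertwines the two diagonal matrices, so an entry
  of \<open>W\<close> can be nonzero only between equal eigenvalues. Hence \<open>W\<close> also
  intertwines their images under \<open>f\<close>. This makes the description in
  \<open>mat_fun\<close> unambiguous.\<close>

lemma spec_fun_unique:
  assumes U: "unitary_mat U" and V: "unitary_mat V" and eq: "spec U d = spec V e"
  shows "spec U (\<lambda>i. f (d i)) = spec V (\<lambda>i. f (e i))"
proof -
  define W where "W = adj V ** U"
  have VW: "V ** W = U" using V by (simp add: W_def matrix_mul_assoc unitary_mat_def)
  have WU: "W ** adj U = adj V"
    using U by (simp add: W_def matrix_mul_assoc [symmetric] unitary_mat_def)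
  have diag: "(W ** real_diag g) $ i $ j = W $ i $ j * of_real (g j)"
    "(real_diag h ** W) $ i $ j = of_real (h i) * W $ i $ j" for g h i j
  proof -
    have "(W ** real_diag g) $ i $ j = (\<Sum>k\<in>UNIV. if k = j then W $ i $ j * of_real (g j) else 0)"
      by (simp only: matrix_matrix_mult_def real_diag_def vec_lambda_beta) (rule sum.cong, auto)
    then show "(W ** real_diag g) $ i $ j = W $ i $ j * of_real (g j)" by simp
    have "(real_diag h ** W) $ i $ j = (\<Sum>k\<in>UNIV. if k = i then of_real (h i) * W $ i $ j else 0)"
      by (simp only: matrix_matrix_mult_def real_diag_def vec_lambda_beta) (rule sum.cong, auto)
    then show "(real_diag h ** W) $ i $ j = of_real (h i) * W $ i $ j" by simp
  qed
  have "W ** real_diag d = adj V ** spec U d ** U"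
    using U by (simp add: W_def spec_def matrix_mul_assoc [symmetric] unitary_mat_def)
  also have "\<dots> = (adj V ** V) ** real_diag e ** W"
    unfolding eq by (simp add: W_def spec_def matrix_mul_assoc)
  also have "\<dots> = real_diag e ** W" using V by (simp add: unitary_mat_def)
  finally have "(W ** real_diag d) $ i $ j = (real_diag e ** W) $ i $ j" for i j by simp
  then have "W $ i $ j = 0 \<or> d j = e i" for i j
    by (simp add: diag)
  then have "W $ i $ j * of_real (f (d j)) = of_real (f (e i)) * W $ i $ j" for i j
    by (metis mult.commute mult_zero_left)
  then have W: "W ** real_diag (\<lambda>i. f (d i)) = real_diag (\<lambda>i. f (e i)) ** W"
    by (simp add: vec_eq_iff diag)
  have "spec U (\<lambda>i. f (d i)) = V ** (W ** real_diag (\<lambda>i. f (d i))) ** adj U"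
    by (simp add: spec_def matrix_mul_assoc VW)
  also have "\<dots> = spec V (\<lambda>i. f (e i))"
    unfolding W by (simp add: spec_def matrix_mul_assoc [symmetric] WU)
  finally show ?thesis .
qed

lemma mat_fun_spec:
  assumes U: "unitary_mat U"
  shows "mat_fun f (spec U d) = spec U (\<lambda>i. f (d i))"
  unfolding mat_fun_def
proof (rule the_equality)
  show "\<exists>V e. unitary_mat V \<and> spec U d = V ** real_diag e ** adj V \<and>
    spec U (\<lambda>i. f (d i)) = V ** real_diag (\<lambda>i. f (e i)) ** adj V"
    using U unfolding spec_def by blast
next
  fix B assume "\<exists>V e. unitary_mat V \<and> spec U d = V ** real_diag e ** adj V \<and>
    B = V ** real_diag (\<lambda>i. f (e i)) ** adj V"
  then obtain V e where V: "unitary_mat V" "spec U d = spec V e" "B = spec V (\<lambda>i. f (e i))"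
    unfolding spec_def by blast
  then show "B = spec U (\<lambda>i. f (d i))"
    using spec_fun_unique[OF U V(1,2), of f] by simp
qed

section \<open>Conditional expectations and the main inequality\<close>

lemma matrix_inv_unique:
  fixes A :: "complex^'n^'n"
  assumes "A ** B = mat 1" "B ** A = mat 1"
  shows "matrix_inv A = B"
proof -
  have "A ** matrix_inv A = mat 1 \<and> matrix_inv A ** A = mat 1"
    unfolding matrix_inv_def by (rule someI[of _ B]) (use assms in simp)
  then have "B = B ** (A ** matrix_inv A)" by simp
  also have "\<dots> = matrix_inv A" unfolding matrix_mul_assoc assms by simp
  finally show ?thesis by simp
qed

lemma matrix_inv_spec:
  assumes "unitary_mat U" "\<And>i. d i \<noteq> 0"
  shows "matrix_inv (spec U d) = spec U (\<lambda>i. 1 / d i)"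
  using assms by (intro matrix_inv_unique) (simp_all add: spec_mult spec_1)

lemma spec_pos:
  fixes U :: "complex^'n^'n"
  assumes U: "unitary_mat U" and pos: "pos_semidef (spec U d)" and inv: "invertible (spec U d)"
  shows "0 < d i"
proof -
  define e :: "complex^'n" where "e = axis i 1"
  define x where "x = U *v e"
  have Ux: "adj U *v x = e"
    using U by (simp add: x_def matrix_vector_mul_assoc unitary_mat_def)
  have De: "real_diag d *v e = d i *\<^sub>R e"
  proof -
    have "(real_diag d *v e) $ j =
      (\<Sum>k\<in>UNIV. if k = i then (if j = i then complex_of_real (d i) else 0) else 0)" for j
      by (simp only: matrix_vector_mult_def real_diag_def e_def axis_def vec_lambda_beta)
        (rule sum.cong, auto)
    then show ?thesis by (simp add: vec_eq_iff e_def axis_def of_real_def)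
  qed
  have Ax: "spec U d *v x = U *v (d i *\<^sub>R e)"
    by (simp add: spec_def matrix_vector_mul_assoc [symmetric] Ux De)
  have "0 \<le> Re (cinner x (spec U d *v x))"
    using pos by (simp add: pos_semidef_def cinner_def)
  also have "cinner x (spec U d *v x) = cinner e (d i *\<^sub>R e)"
    unfolding Ax cinner_mult_vec Ux ..
  also have "Re \<dots> = d i"
    by (simp add: Re_cinner e_def inner_axis)
  finally have "0 \<le> d i" .
  moreover have "d i \<noteq> 0"
  proof
    assume "d i = 0"
    then have "spec U d *v x = 0" by (simp add: Ax)
    moreover obtain B where "B ** spec U d = mat 1" using inv by (auto simp: invertible_def)
    ultimately have "x = 0"
      by (metis matrix_vector_mul_assoc matrix_vector_mul_lid matrix_vector_mult_0_right)
    then show False using Ux by (simp add: e_def)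
  qed
  ultimately show ?thesis by simp
qed

section \<open>Algebras and the projection onto them\<close>

lemma subspace_vn_algebra:
  assumes N: "vn_algebra N"
  shows "subspace N"
proof -
  have sc: "c *\<^sub>R X \<in> N" if "X \<in> N" for c X
  proof -
    have "c *\<^sub>R X = map_matrix ((*) (of_real c)) X"
      by (simp add: vec_eq_iff map_matrix_def scaleR_conv_of_real[of c "_ :: complex"])
    then show ?thesis using N that by (simp add: vn_algebra_def)
  qed
  have "mat 1 \<in> N" using N by (simp add: vn_algebra_def)
  from sc[OF this, of 0] have "0 \<in> N" by simp
  then show ?thesis using N sc by (auto simp: subspace_def vn_algebra_def)
qed

lemma vn_algebra_mult: "vn_algebra N \<Longrightarrow> X \<in> N \<Longrightarrow> Y \<in> N \<Longrightarrow> X ** Y \<in> N"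
  and vn_algebra_adj: "vn_algebra N \<Longrightarrow> X \<in> N \<Longrightarrow> adj X \<in> N"
  and vn_algebra_1: "vn_algebra N \<Longrightarrow> mat 1 \<in> N"
  by (simp_all add: vn_algebra_def)

text \<open>Replacing Z by \<i> Z turns the imaginary part of the trace into a real part, so real
  orthogonality to a complex subspace is complex orthogonality.\<close>

lemma tau_inner_eq_0:
  fixes W :: "complex^'n^'n"
  assumes N: "vn_algebra N" and W: "\<And>Z. Z \<in> N \<Longrightarrow> Z \<bullet> W = 0" and Z: "Z \<in> N"
  shows "tau_inner Z W = 0"
proof -
  let ?iZ = "map_matrix ((*) \<i>) Z"
  have "trace (adj ?iZ ** W) = - \<i> * trace (adj Z ** W)"
    by (simp add: trace_def matrix_matrix_mult_def map_matrix_def sum_distrib_left sum_negf mult.assoc)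
  then have "?iZ \<bullet> W = Im (trace (adj Z ** W))"
    by (simp add: inner_matrix)
  moreover have "?iZ \<in> N" using N Z by (simp add: vn_algebra_def)
  ultimately have "trace (adj Z ** W) = 0"
    using W[of ?iZ] W[OF Z] by (simp add: complex_eq_iff inner_matrix)
  then show ?thesis by (simp add: tau_inner_def)
qed

text \<open>The real orthogonal projection onto \<open>N\<close> witnesses the definite description;
  a second candidate would differ from it by an element of \<open>N\<close> orthogonal to
  itself.\<close>

lemma tracial_cond_exp:
  fixes X :: "complex^'n^'n"
  assumes N: "vn_algebra N"
  shows "tracial_cond_exp N X \<in> N"
    and "Z \<in> N \<Longrightarrow> X \<bullet> Z = tracial_cond_exp N X \<bullet> Z"
proof -
  have sub: "subspace N" by (rule subspace_vn_algebra[OF N])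
  have inner: "Z \<bullet> W = 0" if "tau_inner Z W = 0" for Z W :: "complex^'n^'n"
    using that by (simp add: tau_inner_def inner_matrix)
  obtain Y W where Y: "Y \<in> span N" and W: "\<And>Z. Z \<in> span N \<Longrightarrow> orthogonal W Z" and "X = Y + W"
    using orthogonal_subspace_decomp_exists[of N X] by metis
  have "Y \<in> N" using Y sub by (metis span_eq_iff)
  have "\<exists>!Y. Y \<in> N \<and> (\<forall>Z\<in>N. tau_inner Z (X - Y) = 0)"
  proof (rule ex1I[of _ Y])
    show "Y \<in> N \<and> (\<forall>Z\<in>N. tau_inner Z (X - Y) = 0)"
      using \<open>Y \<in> N\<close> W \<open>X = Y + W\<close>
      by (auto intro!: tau_inner_eq_0[OF N] simp: orthogonal_def span_base inner_commute[of _ W])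
  next
    fix Y' assume Y': "Y' \<in> N \<and> (\<forall>Z\<in>N. tau_inner Z (X - Y') = 0)"
    have D: "Y - Y' \<in> N" using \<open>Y \<in> N\<close> Y' sub by (simp add: subspace_diff)
    have "(Y - Y') \<bullet> (X - Y') = 0" using D Y' inner by blast
    moreover have "(Y - Y') \<bullet> W = 0" using W[OF span_base[OF D]] by (simp add: orthogonal_def inner_commute)
    moreover have "X - Y' = (Y - Y') + W" using \<open>X = Y + W\<close> by simp
    ultimately have "(Y - Y') \<bullet> (Y - Y') = 0" by (simp only: inner_add_right)
    then show "Y' = Y" by simp
  qed
  then have *: "tracial_cond_exp N X \<in> N \<and> (\<forall>Z\<in>N. tau_inner Z (X - tracial_cond_exp N X) = 0)"
    unfolding tracial_cond_exp_def by (rule theI')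
  then show "tracial_cond_exp N X \<in> N" by blast
  show "X \<bullet> Z = tracial_cond_exp N X \<bullet> Z" if "Z \<in> N"
    using inner[of Z "X - tracial_cond_exp N X"] * that
    by (simp add: inner_diff_right inner_commute[of _ Z])
qed

text \<open>The adjoint is an isometry that preserves \<open>N\<close>, so it commutes with the
  orthogonal projection onto \<open>N\<close>.\<close>

lemma adj_tracial_cond_exp:
  fixes X :: "complex^'n^'n"
  assumes N: "vn_algebra N" and X: "adj X = X"
  shows "adj (tracial_cond_exp N X) = tracial_cond_exp N X"
proof -
  define Y where "Y = tracial_cond_exp N X"
  have Y: "Y \<in> N" "adj Y \<in> N" by (simp_all add: Y_def tracial_cond_exp(1) N vn_algebra_adj)
  then have D: "Y - adj Y \<in> N" "adj (Y - adj Y) \<in> N"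
    using N by (simp_all add: subspace_vn_algebra subspace_diff vn_algebra_adj)
  have "Y \<bullet> (Y - adj Y) = X \<bullet> (Y - adj Y)"
    unfolding Y_def by (rule tracial_cond_exp(2)[OF N, symmetric]) (use D in \<open>simp add: Y_def\<close>)
  also have "\<dots> = X \<bullet> adj (Y - adj Y)" using inner_adj[of X "Y - adj Y"] by (simp add: X)
  also have "\<dots> = Y \<bullet> adj (Y - adj Y)"
    unfolding Y_def by (rule tracial_cond_exp(2)[OF N]) (use D in \<open>simp add: Y_def\<close>)
  also have "\<dots> = adj Y \<bullet> (Y - adj Y)" using inner_adj[of "adj Y" "Y - adj Y"] by simp
  finally have "(Y - adj Y) \<bullet> (Y - adj Y) = 0" by (simp add: inner_diff_left)
  then show ?thesis by (simp add: Y_def)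
qed

lemma fcalc_sandwich:
  assumes "unitary_mat V" "unitary_mat U" "\<And>i j. f (a (i, j)) = g i * h j"
  shows "spectral_operator.fcalc (sandwich V U) a f X = spec V g ** X ** spec U h"
  using assms
  by (simp add: spectral_operator.fcalc_def[OF spectral_operator_sandwich] sum_sandwich [symmetric])
    (metis prod.collapse)

text \<open>Left multiplication by an element of \<open>N\<close> maps \<open>N\<close> to itself,
  hence so do its functions; applied to the identity they return the functions of the
  element.\<close>

lemma spec_fun_in_vn_algebra:
  assumes N: "vn_algebra N" and U: "unitary_mat U" and d: "spec U d \<in> N"
  shows "spec U (\<lambda>i. f (d i)) \<in> N"
proof -
  interpret spectral_operator "sandwich U U" "\<lambda>k. d (fst k)"
    by (rule spectral_operator_sandwich[OF U U])
  have *: "fcalc g X = spec U (\<lambda>i. g (d i)) ** X" for g X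
    using fcalc_sandwich[OF U U, of g "\<lambda>k. d (fst k)" "\<lambda>i. g (d i)" "\<lambda>j. 1" X] U
    by (simp add: spec_1)
  have "fcalc f (mat 1) \<in> N"
    by (rule fcalc_invariant[OF subspace_vn_algebra[OF N]])
      (simp_all add: * vn_algebra_mult[OF N] vn_algebra_1[OF N] d)
  then show ?thesis by (simp add: *)
qed

lemma faithful_state_spec:
  assumes "faithful_state M \<rho>"
  obtains U r where "unitary_mat U" "\<rho> = spec U r" "\<And>i. 0 < r i"
proof -
  have \<rho>: "pos_semidef \<rho>" "invertible \<rho>" "adj \<rho> = \<rho>"
    using assms by (auto simp: faithful_state_def density_matrix_def pos_semidef_def)
  from \<rho>(3) obtain U r where "unitary_mat U" "\<rho> = spec U r" by (rule hermitian_diagonalizable)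
  with \<rho> show thesis by (intro that[of U r] spec_pos[of U r]) simp_all
qed

text \<open>An eigenprojection Y of the expected state lies in \<open>N\<close>, so pairing it with
  that state or with \<rho> gives the same number. The first pairing is the eigenvalue times
  \<open>Y \<bullet> Y\<close>, the second is positive because \<rho> is.\<close>

lemma tracial_cond_exp_spec:
  fixes \<rho> :: "complex^'n^'n"
  assumes N: "vn_algebra N" and \<rho>: "faithful_state M \<rho>"
  obtains U r where "unitary_mat U" "tracial_cond_exp N \<rho> = spec U r" "\<And>i. 0 < r i"
proof -
  obtain V s where V: "unitary_mat V" "\<rho> = spec V s" "\<And>i. 0 < s i"
    using faithful_state_spec[OF \<rho>] by blast
  have "adj (tracial_cond_exp N \<rho>) = tracial_cond_exp N \<rho>"
    by (rule adj_tracial_cond_exp[OF N]) (simp add: V)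
  then obtain U r where U: "unitary_mat U" and r: "tracial_cond_exp N \<rho> = spec U r"
    by (rule hermitian_diagonalizable)
  have "0 < r i" for i
  proof -
    \<comment> \<open>The indicator of the value \<open>r i\<close>, not of the index
      \<open>i\<close>: only the projection onto the whole eigenspace is a function of the matrix
      and thus in \<open>N\<close>.\<close>
    define p where "p x = (if x = r i then 1 else 0 :: real)" for x
    define Y where "Y = spec U (\<lambda>j. p (r j))"
    have YN: "Y \<in> N"
      unfolding Y_def by (rule spec_fun_in_vn_algebra[OF N U, of r])
        (use tracial_cond_exp(1)[OF N, of \<rho>] in \<open>simp add: r\<close>)
    have "(\<lambda>j. p (r j) * p (r j)) = (\<lambda>j. p (r j))" by (simp add: p_def fun_eq_iff)
    then have YY: "Y ** Y = Y" by (simp add: Y_def spec_mult U)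
    have "(\<lambda>j. r j * p (r j)) = (\<lambda>j. r i * p (r j))" by (simp add: p_def fun_eq_iff)
    then have rY: "spec U r ** Y = spec U (\<lambda>j. r i) ** Y" by (simp add: Y_def spec_mult U)
    have c: "spec U (\<lambda>j. r i) = r i *\<^sub>R mat 1"
    proof -
      have "spec U (\<lambda>j. r i) = r i *\<^sub>R spec U (\<lambda>j. 1)"
        unfolding sum_spec_proj[of "\<lambda>j. r i" U, symmetric] sum_spec_proj[of "\<lambda>j. 1" U, symmetric]
        by (simp add: scaleR_right.sum)
      then show ?thesis using U by (simp add: spec_1)
    qed
    have "Y \<noteq> 0"
    proof
      assume "Y = 0"
      then have "adj U ** Y ** U = 0" by (simp add: linear_0[OF linear_matrix_sandwich])
      moreover have "adj U ** Y ** U = (adj U ** U) ** real_diag (\<lambda>j. p (r j)) ** (adj U ** U)"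
        by (simp add: Y_def spec_def matrix_mul_assoc)
      ultimately have "real_diag (\<lambda>j. p (r j)) $ i $ i = 0"
        using U by (simp add: unitary_mat_def)
      then show False by (simp add: real_diag_def p_def)
    qed
    have aY: "adj Y = Y" by (simp add: Y_def)
    have swap: "Z \<bullet> Y = (Z ** Y) \<bullet> Y" for Z
      using inner_mult_right[of Z Y Y] by (simp add: aY YY)
    define h where "h = spec V (\<lambda>j. sqrt (s j))"
    have hh: "h ** h = \<rho>" using V by (simp add: h_def spec_mult less_imp_le abs_of_pos)
    have "\<rho> \<bullet> Y = (h ** (h ** Y)) \<bullet> Y"
      unfolding swap[of \<rho>] by (simp add: hh [symmetric] matrix_mul_assoc)
    also have "\<dots> = (h ** Y) \<bullet> (h ** Y)"
      by (subst inner_mult_left) (simp add: h_def)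
    also have "\<dots> > 0"
    proof -
      have "spec V (\<lambda>j. 1 / sqrt (s j)) ** h = mat 1"
        using V(1,3) by (simp add: h_def spec_mult less_imp_neq[THEN not_sym] spec_1)
      then have "Y = spec V (\<lambda>j. 1 / sqrt (s j)) ** (h ** Y)"
        by (simp add: matrix_mul_assoc)
      then have "h ** Y \<noteq> 0"
        using \<open>Y \<noteq> 0\<close> linear_0[OF linear_matrix_mult_left] by metis
      then show ?thesis by simp
    qed
    also have "\<rho> \<bullet> Y = r i * (Y \<bullet> Y)"
      unfolding tracial_cond_exp(2)[OF N YN, where X = \<rho>] r swap[of "spec U r"] rY c
      by (simp add: matrix_mult_scaleR_left)
    finally show ?thesis
      using inner_ge_zero[of Y] by (auto simp: zero_less_mult_iff)
  qed
  with U r show thesis by (rule that)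
qed

text \<open>Araki's form of the relative entropy. The logarithm of the modular operator multiplies
  by log \<sigma> on the left and subtracts multiplication by log \<rho> on the right; the latter
  commutes past the square root \<open>h\<close> of \<rho>.\<close>

lemma rel_entropy_spec:
  assumes U: "unitary_mat U" and V: "unitary_mat V" and r: "\<And>i. 0 < r i" and s: "\<And>i. 0 < s i"
  defines "h \<equiv> spec U (\<lambda>i. sqrt (r i))"
  shows "rel_entropy (spec U r) (spec V s) =
    - (h \<bullet> spectral_operator.fcalc (sandwich V U) (\<lambda>k. s (fst k) / r (snd k)) ln h)"
proof -
  interpret spectral_operator "sandwich V U" "\<lambda>k. s (fst k) / r (snd k)"
    by (rule spectral_operator_sandwich[OF V U])
  let ?lr = "spec U (\<lambda>i. ln (r i))" and ?ls = "spec V (\<lambda>i. ln (s i))"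
  have hh: "h ** h = spec U r"
    using r by (simp add: h_def spec_mult U less_imp_le abs_of_pos)
  have comm: "?lr ** h = h ** ?lr" by (simp add: h_def spec_mult U mult.commute)
  have "fcalc ln h = (\<Sum>k\<in>UNIV. (ln (s (fst k)) * 1) *\<^sub>R sandwich V U k h)
    - (\<Sum>k\<in>UNIV. (1 * ln (r (snd k))) *\<^sub>R sandwich V U k h)"
    using r s r[THEN less_imp_neq] s[THEN less_imp_neq]
    by (simp add: fcalc_def ln_div scaleR_diff_left sum_subtractf)
  also have "\<dots> = ?ls ** h - h ** ?lr"
    using sum_sandwich[of "\<lambda>i. ln (s i)" "\<lambda>i. 1" V U h] sum_sandwich[of "\<lambda>i. 1" "\<lambda>i. ln (r i)" V U h] U V
    by (simp add: spec_1)
  finally have f: "fcalc ln h = ?ls ** h - h ** ?lr" .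
  have "rel_entropy (spec U r) (spec V s) = (h ** h) \<bullet> (?lr - ?ls)"
    by (simp add: rel_entropy_def mat_log_def mat_fun_spec U V hh inner_matrix)
  also have "\<dots> = h \<bullet> ((?lr - ?ls) ** h)"
    by (subst inner_mult_right) (simp add: h_def)
  also have "(?lr - ?ls) ** h = - fcalc ln h"
    by (simp add: f comm [symmetric] linear_diff[OF linear_matrix_mult_right])
  finally show ?thesis by simp
qed

text \<open>A real supremum bounds its members only if the set is bounded above; finite dimension
  supplies this bound.\<close>

lemma op_norm_on_upper:
  assumes "linear T" "X \<in> M" "hs_norm X \<le> 1"
  shows "hs_norm (T X) \<le> op_norm_on M T"
  unfolding op_norm_on_def
proof (rule cSUP_upper)
  obtain B where B: "0 < B" "\<And>X. norm (T X) \<le> B * norm X"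
    using linear_bounded_pos[OF assms(1)] by blast
  have "hs_norm (T X) \<le> B" if "hs_norm X \<le> 1" for X
  proof -
    have "B * norm X \<le> B * 1" using that B(1) by (intro mult_left_mono) (simp_all add: norm_matrix)
    with B(2)[of X] show ?thesis by (simp add: norm_matrix)
  qed
  then show "bdd_above ((\<lambda>X. hs_norm (T X)) ` {X \<in> M. hs_norm X \<le> 1})"
    by (intro bdd_aboveI2[of _ _ B]) simp
qed (use assms in simp)

theorem theorem1p5:
  fixes M N :: "(complex^'n^'n) set"
    and \<rho> \<sigma> \<rho>N \<sigma>N :: "complex^'n^'n"
  assumes "vn_algebra M"
    and "vn_algebra N" and "N \<subseteq> M"
    and "faithful_state M \<rho>" and "faithful_state M \<sigma>"
    and "\<rho>N = tracial_cond_exp N \<rho>" and "\<sigma>N = tracial_cond_exp N \<sigma>"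
  shows "rel_entropy \<rho> \<sigma> - rel_entropy \<rho>N \<sigma>N
    \<ge> (pi / 4) ^ 4 * op_norm_on M (rel_modular \<sigma> \<rho>) powi (-2)
       * hs_norm (mat_powr \<sigma>N (1/2) ** mat_powr \<rho>N (-1/2) ** mat_powr \<rho> (1/2)
                    - mat_powr \<sigma> (1/2)) ^ 4"
proof -
  note M = \<open>vn_algebra M\<close> and N = \<open>vn_algebra N\<close>
  obtain U r where U: "unitary_mat U" and \<rho>: "\<rho> = spec U r" and r: "\<And>i. 0 < r i"
    using faithful_state_spec[OF assms(4)] by blast
  obtain V s where V: "unitary_mat V" and \<sigma>: "\<sigma> = spec V s" and s: "\<And>i. 0 < s i"
    using faithful_state_spec[OF assms(5)] by blast
  obtain U' r' where U': "unitary_mat U'" and \<rho>N: "\<rho>N = spec U' r'" and r': "\<And>i. 0 < r' i"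
    using tracial_cond_exp_spec[OF N assms(4)] assms(6) by metis
  obtain V' s' where V': "unitary_mat V'" and \<sigma>N: "\<sigma>N = spec V' s'" and s': "\<And>i. 0 < s' i"
    using tracial_cond_exp_spec[OF N assms(5)] assms(7) by metis
  have r0: "r i \<noteq> 0" and s0: "s i \<noteq> 0" and r'0: "r' i \<noteq> 0" and s'0: "s' i \<noteq> 0" for i
    using r[of i] s[of i] r'[of i] s'[of i] by auto
  define h where "h = spec U (\<lambda>i. sqrt (r i))"
  define v where "v = spec U' (\<lambda>i. sqrt (r' i))"
  define R where "R = spec U' (\<lambda>i. 1 / sqrt (r' i))"
  let ?\<rho>i = "spec U (\<lambda>i. 1 / r i)" and ?\<rho>Ni = "spec U' (\<lambda>i. 1 / r' i)"
  have adj_h: "adj h = h" and adj_R: "adj R = R" and adj_v: "adj v = v"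
    by (simp_all add: h_def R_def v_def)
  have hh: "h ** h = \<rho>" and vv: "v ** v = \<rho>N"
    using r r' by (simp_all add: h_def v_def \<rho> \<rho>N spec_mult U U' less_imp_le abs_of_pos)
  have hih: "h ** ?\<rho>i ** h = mat 1"
  proof -
    have "(\<lambda>i. sqrt (r i) * (1 / r i) * sqrt (r i)) = (\<lambda>i. 1)"
      using r by (simp add: fun_eq_iff r0 less_imp_le)
    then show ?thesis by (simp only: h_def spec_mult U spec_1)
  qed
  have R\<rho>R: "R ** \<rho>N ** R = mat 1"
  proof -
    have "(\<lambda>i. 1 / sqrt (r' i) * r' i * (1 / sqrt (r' i))) = (\<lambda>i. 1)"
      using r' by (simp add: fun_eq_iff r'0 less_imp_le)
    then show ?thesis by (simp only: R_def \<rho>N spec_mult U' spec_1)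
  qed
  have RR: "R ** R = ?\<rho>Ni"
    using r' by (simp add: R_def spec_mult U' less_imp_le abs_of_pos)
  have vR: "v ** R = mat 1"
    by (simp add: v_def R_def spec_mult U' r'0 spec_1)
  have inN: "spec U' (\<lambda>i. f (r' i)) \<in> N" for f
    by (rule spec_fun_in_vn_algebra[OF N U', of r'])
      (metis tracial_cond_exp(1)[OF N] assms(6) \<rho>N)
  have RN: "R \<in> N" and vN: "v \<in> N" and iN: "?\<rho>Ni \<in> N"
    using inN[of "\<lambda>x. 1 / sqrt x"] inN[of sqrt] inN[of "\<lambda>x. 1 / x"] by (simp_all add: R_def v_def)
  have \<sigma>NN: "\<sigma>N \<in> N" using tracial_cond_exp(1)[OF N, of \<sigma>] assms(7) by simp
  have E\<rho>: "\<rho> \<bullet> Z = \<rho>N \<bullet> Z" and E\<sigma>: "\<sigma> \<bullet> Z = \<sigma>N \<bullet> Z" if "Z \<in> N" for Z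
    using tracial_cond_exp(2)[OF N that] assms(6,7) by simp_all
  \<comment> \<open>Cyclicity brings \<rho> to face \<open>adj Y ** X\<close>, an element of
    \<open>N\<close>, where it may be exchanged for \<open>\<rho>N\<close>.\<close>
  have right: "(X ** h) \<bullet> (Y ** h) = X \<bullet> (Y ** \<rho>N)" if "X \<in> N" "Y \<in> N" for X Y
  proof -
    have "(X ** h) \<bullet> (Y ** h) = X \<bullet> (Y ** \<rho>)"
      by (simp add: inner_mult_right[of X] adj_h hh [symmetric] matrix_mul_assoc)
    also have "\<dots> = \<rho> \<bullet> (adj Y ** X)"
      using inner_mult_left[of Y \<rho> X] by (simp add: inner_commute)
    also have "\<dots> = \<rho>N \<bullet> (adj Y ** X)"
      using that N by (intro E\<rho> vn_algebra_mult vn_algebra_adj)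
    also have "\<dots> = X \<bullet> (Y ** \<rho>N)"
      using inner_mult_left[of Y \<rho>N X] by (simp add: inner_commute)
    finally show ?thesis .
  qed
  have left: "X \<bullet> (\<sigma> ** Y) = X \<bullet> (\<sigma>N ** Y)" if "X \<in> N" "Y \<in> N" for X Y
  proof -
    have "X \<bullet> (\<sigma> ** Y) = \<sigma> \<bullet> (X ** adj Y)"
      using inner_mult_right[of \<sigma> Y X] by (simp add: inner_commute)
    also have "\<dots> = \<sigma>N \<bullet> (X ** adj Y)"
      using that N by (intro E\<sigma> vn_algebra_mult vn_algebra_adj)
    also have "\<dots> = X \<bullet> (\<sigma>N ** Y)"
      using inner_mult_right[of \<sigma>N Y X] by (simp add: inner_commute)
    finally show ?thesis .
  qed
  let ?a = "\<lambda>k. s (fst k) / r (snd k)" and ?b = "\<lambda>k. s' (fst k) / r' (snd k)"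
  interpret D: spectral_operator "sandwich V U" ?a by (rule spectral_operator_sandwich[OF V U])
  interpret E: spectral_operator "sandwich V' U'" ?b by (rule spectral_operator_sandwich[OF V' U'])
  have D_id: "D.fcalc (\<lambda>t. t) X = \<sigma> ** X ** ?\<rho>i" for X
    unfolding \<sigma> by (rule fcalc_sandwich[OF V U]) simp
  have E_id: "E.fcalc (\<lambda>t. t) X = \<sigma>N ** X ** ?\<rho>Ni" for X
    unfolding \<sigma>N by (rule fcalc_sandwich[OF V' U']) simp
  have D_sqrt: "D.fcalc sqrt X = spec V (\<lambda>i. sqrt (s i)) ** X ** spec U (\<lambda>i. 1 / sqrt (r i))" for X
    by (rule fcalc_sandwich[OF V U]) (simp add: real_sqrt_divide)
  have E_sqrt: "E.fcalc sqrt X = spec V' (\<lambda>i. sqrt (s' i)) ** X ** R" for X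
    unfolding R_def by (rule fcalc_sandwich[OF V' U']) (simp add: real_sqrt_divide)
  let ?J = "\<lambda>X. X ** R ** h"
  interpret C: spectral_compression "sandwich V U" ?a "sandwich V' U'" ?b ?J N v
  proof (rule spectral_compression.intro[OF spectral_operator_sandwich[OF V U]
      spectral_operator_sandwich[OF V' U']], rule spectral_compression_axioms.intro)
    fix x y assume x: "x \<in> N" and y: "y \<in> N"
    have xR: "x ** R \<in> N" and yR: "y ** R \<in> N" using x y RN N by (simp_all add: vn_algebra_mult)
    have xRR: "(x ** R) \<bullet> (Z ** R) = x \<bullet> (Z ** ?\<rho>Ni)" for Z
      by (simp add: inner_mult_right[of x] adj_R RR [symmetric] matrix_mul_assoc)
    have "?J x \<bullet> ?J y = (x ** R) \<bullet> (y ** R ** \<rho>N)" by (rule right[OF xR yR])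
    also have "\<dots> = x \<bullet> (y ** (R ** \<rho>N ** R))"
      by (simp add: inner_mult_right[of x] adj_R matrix_mul_assoc)
    finally show "?J x \<bullet> ?J y = x \<bullet> y" by (simp add: R\<rho>R)
    \<comment> \<open>The inverse of \<rho> in the modular operator is absorbed by the two factors
      \<open>h\<close> from \<open>?J\<close>, so only \<sigma> remains to be exchanged for
      \<open>\<sigma>N\<close>.\<close>
    have "?J x \<bullet> D.fcalc (\<lambda>t. t) (?J y) = (x ** R) \<bullet> (\<sigma> ** (y ** R) ** (h ** ?\<rho>i ** h))"
      by (simp add: D_id inner_mult_right[of "x ** R"] adj_h matrix_mul_assoc)
    also have "\<dots> = (x ** R) \<bullet> (\<sigma>N ** (y ** R))" by (simp add: hih left[OF xR yR])
    also have "\<dots> = x \<bullet> E.fcalc (\<lambda>t. t) y"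
      using xRR[of "\<sigma>N ** y"] by (simp add: E_id matrix_mul_assoc)
    finally show "?J x \<bullet> D.fcalc (\<lambda>t. t) (?J y) = x \<bullet> E.fcalc (\<lambda>t. t) y" .
  next
    fix x assume "x \<in> N"
    then show "E.fcalc (\<lambda>t. t) x \<in> N"
      unfolding E_id by (intro vn_algebra_mult N \<sigma>NN iN)
  next
    have "v \<bullet> v = \<rho>N \<bullet> mat 1"
      using inner_mult_right[of v v "mat 1"] by (simp add: adj_v vv)
    also have "\<dots> = \<rho> \<bullet> mat 1" by (simp add: E\<rho> vn_algebra_1[OF N])
    also have "\<dots> = 1"
      using assms(4) by (simp add: inner_matrix faithful_state_def density_matrix_def pos_semidef_def)
    finally show "norm v = 1" by (simp add: norm_eq_sqrt_inner)
  next
    show "linear ?J"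
      using linear_compose[OF linear_matrix_mult_right[of R] linear_matrix_mult_right[of h]]
      by (simp add: o_def)
  qed (simp_all add: s r s' r' vN subspace_vn_algebra[OF N])
  have Jv: "?J v = h" by (simp add: vR)
  define K where "K = op_norm_on M (rel_modular \<sigma> \<rho>)"
  have mod: "rel_modular \<sigma> \<rho> = D.fcalc (\<lambda>t. t)"
    by (simp add: fun_eq_iff rel_modular_def D_id \<rho> matrix_inv_spec U r0)
  \<comment> \<open>\<open>?J v\<close> equals \<open>h\<close>, a unit vector of \<open>M\<close>,
    so it competes in the supremum over \<open>M\<close>.\<close>
  have K: "norm (D.fcalc (\<lambda>t. t) (?J v)) \<le> K"
  proof -
    have "h \<in> M"
      unfolding h_def by (rule spec_fun_in_vn_algebra[OF M U, of r])
        (use assms(4) in \<open>simp add: \<rho> faithful_state_def density_matrix_def\<close>)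
    then show ?thesis
      unfolding K_def mod Jv norm_matrix
      using C.norm_Jv by (intro op_norm_on_upper D.linear_fcalc) (simp_all add: Jv norm_matrix)
  qed
  \<comment> \<open>The modular operator is invertible and \<open>?J v\<close> is a unit vector, so
    its image is nonzero; this allows division by \<open>K\<close>.\<close>
  have "0 < norm (D.fcalc (\<lambda>t. t) (?J v))"
  proof -
    have "D.fcalc (\<lambda>t. 1 / t) (D.fcalc (\<lambda>t. t) (?J v)) = D.fcalc (\<lambda>t. 1) (?J v)"
      unfolding D.fcalc_fcalc by (rule D.fcalc_cong) (simp add: s0 r0)
    also have "\<dots> = ?J v" by (simp add: D.fcalc_const)
    finally have "D.fcalc (\<lambda>t. t) (?J v) \<noteq> 0"
      using C.norm_Jv linear_0[OF D.linear_fcalc] by (metis norm_zero zero_neq_one)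
    then show ?thesis by simp
  qed
  with K have "0 < K" by linarith
  have gap: "C.gap = rel_entropy \<rho> \<sigma> - rel_entropy \<rho>N \<sigma>N"
    unfolding C.gap_def Jv using rel_entropy_spec[OF U V r s] rel_entropy_spec[OF U' V' r' s']
    by (simp add: \<rho> \<sigma> \<rho>N \<sigma>N h_def v_def)
  have powr: "mat_powr \<sigma>N (1/2) = spec V' (\<lambda>i. sqrt (s' i))" "mat_powr \<sigma> (1/2) = spec V (\<lambda>i. sqrt (s i))"
    "mat_powr \<rho> (1/2) = h" "mat_powr \<rho>N (-1/2) = R"
    using r s r' s'
    by (simp_all add: mat_powr_def \<rho> \<sigma> \<rho>N \<sigma>N mat_fun_spec U V U' V' h_def R_def powr_half_sqrt
      powr_minus_divide less_imp_le)
  \<comment> \<open>The right factors collapse: the inverse square root of \<rho> cancels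
    \<open>h\<close>, and \<open>R\<close> cancels \<open>v\<close>. The sign is opposite to that in
    the claim, which the norm ignores.\<close>
  have "C.sqrt_defect = mat_powr \<sigma> (1/2) - mat_powr \<sigma>N (1/2) ** mat_powr \<rho>N (-1/2) ** mat_powr \<rho> (1/2)"
  proof -
    have "D.fcalc sqrt h = spec V (\<lambda>i. sqrt (s i))"
      using U by (simp add: D_sqrt h_def matrix_mul_assoc [symmetric] spec_mult r0 spec_1)
    moreover have "E.fcalc sqrt v = spec V' (\<lambda>i. sqrt (s' i))"
      by (simp add: E_sqrt matrix_mul_assoc [symmetric] vR)
    ultimately show ?thesis unfolding C.sqrt_defect_def Jv powr by simp
  qed
  then have defect: "norm C.sqrt_defect = hs_norm (mat_powr \<sigma>N (1/2) ** mat_powr \<rho>N (-1/2) ** mat_powr \<rho> (1/2)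
      - mat_powr \<sigma> (1/2))"
    by (simp only: norm_matrix [symmetric] norm_minus_commute[of "mat_powr \<sigma> (1/2)"])
  have "K powi (-2) = inverse (K\<^sup>2)"
    using power_int_minus[of K 2] by simp
  then have eq: "(pi / 4) ^ 4 * K powi (-2) * n ^ 4 = (pi / 4) ^ 4 * n ^ 4 / K\<^sup>2" for n
    by (simp only: divide_inverse mult_ac)
  show ?thesis
    unfolding K_def [symmetric] gap [symmetric] defect [symmetric] eq
    by (rule C.sqrt_defect_bound[OF K \<open>0 < K\<close>])
qed

end
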